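(* Let $(I\times\Omega,\mathcal I\boxtimes\mathcal F,\lambda\boxtimes P)$ be a Fubini extension and let $f$ be a process from $(I\times\Omega,\mathcal I\boxtimes\mathcal F,\lambda\boxtimes P)$ to a Polish space $X$ with Borel $\sigma$-algebra $\mathcal B$. Let $\underline{\mathcal C}^f$ be the $\sigma$-algebra on $\Omega$ generated by the $\mathcal F$-measurable mappings $\omega\mapsto\lambda((f^A_\omega)^{-1}(B))$, $A\in\mathcal I$, $B\in\mathcal B$, together with the $P$-null sets, where $f^A$ is the restriction of $f$ to $A\times\Omega$. Then: (1) the $\sigma$-algebra $\underline{\mathcal C}^f$ is countably generated; (2) the process $f$ has no coalitional individual uncertainty in aggregation given $\underline{\mathcal C}^f$; (3) the process $f$ is essentially pairwise conditionally independent given $\underline{\mathcal C}^f$.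
   Context: All probability spaces are countably additive and complete. $(I,\mathcal I,\lambda)$ is an atomless probability space and $(\Omega,\mathcal F,P)$ is a probability space. A probability space $(I\times\Omega,\mathcal W,Q)$ extending the usual product space $(I\times\Omega,\mathcal I\otimes\mathcal F,\lambda\otimes P)$ is a Fubini extension if for every real-valued $Q$-integrable function $h$ on $(I\times\Omega,\mathcal W)$: (1) $h_i=h(i,\cdot)$ is integrable on $(\Omega,\mathcal F,P)$ for $\lambda$-almost all $i$, and $h_\omega=h(\cdot,\omega)$ is integrable on $(I,\mathcal I,\lambda)$ for $P$-almost all $\omega$; (2) $i\mapsto\int_\Omega h_i\,dP$ and $\omega\mapsto\int_I h_\omega\,d\lambda$ are integrable on $(I,\mathcal I,\lambda)$ and $(\Omega,\mathcal F,P)$ respectively, and $\int h\,dQ=\int_I\int_\Omega h_i\,dP\,d\lambda=\int_\Omega\int_I h_\omega\,d\lambda\,dP$. It is then denoted $(I\times\Omega,\mathcal I\boxtimes\mathcal F,\lambda\boxtimes P)$. Sub-$\sigma$-algebras $\mathcal C$ of $\mathcal F$ that are conditioned on are assumed to contain all $P$-null sets of $\mathcal F$; "countably generated" means generated by a countable family of sets together with the $P$-null sets. A process from the Fubini extension to a Polish space $X$ is an $\mathcal I\boxtimes\mathcal F$-measurable map $f:I\times\Omega\to X$; write $f_i=f(i,\cdot)$, $f_\omega=f(\cdot,\omega)$. (For $P$-almost all $\omega$ the map $f_\omega$ is $\mathcal I$-measurable, so the maps $\omega\mapsto\lambda((f^A_\omega)^{-1}(B))$ are defined $P$-almost everywhere;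 values on a $P$-null set are irrelevant.) Random variables $\phi,\psi:\Omega\to X$ are conditionally independent given $\mathcal C$ if $P(\phi^{-1}(B_1)\cap\psi^{-1}(B_2)|\mathcal C)=P(\phi^{-1}(B_1)|\mathcal C)P(\psi^{-1}(B_2)|\mathcal C)$ for all $B_1,B_2\in\mathcal B$. The process $f$ is essentially pairwise conditionally independent given $\mathcal C$ if for $\lambda$-almost all $i_1\in I$, $f_{i_1}$ and $f_{i_2}$ are conditionally independent given $\mathcal C$ for $\lambda$-almost all $i_2\in I$. For a countably generated sub-$\sigma$-algebra $\mathcal C$ of $\mathcal F$, let $\mu$ be a regular conditional distribution of $f$ given $\mathcal I\otimes\mathcal C$ (on the probability space $(I\times\Omega,\mathcal I\boxtimes\mathcal F,\lambda\boxtimes P)$), with value $\mu_{i\omega}$ at $(i,\omega)$, a Borel probability measure on $X$. The process $f$ has no coalitional individual uncertainty in aggregation given $\mathcal C$ if for any $A\in\mathcal I$ and for $P$-almost all $\omega\in\Omega$, $\lambda((f^A_\omega)^{-1}(B))=\int_A\mu_{i\omega}(B)\,d\lambda(i)$ for every $B\in\mathcal B$. *)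

theory Defs
  imports "HOL-Probability.Probability"
begin

definition atomless :: "'a measure \<Rightarrow> bool" where
  "atomless M \<longleftrightarrow>
     (\<forall>A\<in>sets M. 0 < emeasure M A \<longrightarrow>
        (\<exists>B\<in>sets M. B \<subseteq> A \<and> 0 < emeasure M B \<and> emeasure M B < emeasure M A))"

text \<open>
  The Bochner integral of a function that is not integrable is 0. This only affects the inner
  integrals at points of a null set.
\<close>

definition fubini_extension :: "'i measure \<Rightarrow> 'w measure \<Rightarrow> ('i \<times> 'w) measure \<Rightarrow> bool" where
  "fubini_extension L P Q \<longleftrightarrow>
     prob_space Q \<and> complete_measure Q \<and>
     subalgebra Q (L \<Otimes>\<^sub>M P) \<and>
     (\<forall>E\<in>sets (L \<Otimes>\<^sub>M P). emeasure Q E = emeasure (L \<Otimes>\<^sub>M P) E) \<and>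
     (\<forall>h :: 'i \<times> 'w \<Rightarrow> real. integrable Q h \<longrightarrow>
        (AE i in L. integrable P (\<lambda>\<omega>. h (i, \<omega>))) \<and>
        (AE \<omega> in P. integrable L (\<lambda>i. h (i, \<omega>))) \<and>
        integrable L (\<lambda>i. \<integral>\<omega>. h (i, \<omega>) \<partial>P) \<and>
        integrable P (\<lambda>\<omega>. \<integral>i. h (i, \<omega>) \<partial>L) \<and>
        (\<integral>x. h x \<partial>Q) = (\<integral>i. (\<integral>\<omega>. h (i, \<omega>) \<partial>P) \<partial>L) \<and>
        (\<integral>x. h x \<partial>Q) = (\<integral>\<omega>. (\<integral>i. h (i, \<omega>) \<partial>L) \<partial>P))"

text \<open>
  A sub-\<open>\<sigma>\<close>-algebra is represented, as in the library's treatment of conditional expectations, by a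
  measure of which only the space and the measurable sets matter.
\<close>

definition generated_with_null_sets :: "'w measure \<Rightarrow> 'w set set \<Rightarrow> 'w measure" where
  "generated_with_null_sets P G = sigma (space P) (G \<union> null_sets P)"

definition countably_generated :: "'w measure \<Rightarrow> 'w measure \<Rightarrow> bool" where
  "countably_generated P C \<longleftrightarrow>
     subalgebra P C \<and>
     (\<exists>G. countable G \<and> G \<subseteq> sets P \<and> sets C = sets (generated_with_null_sets P G))"

text \<open>
  \<open>coalition_share L f A B \<omega>\<close> is the measure of the preimage of \<open>B\<close> under the section of \<open>f\<close> at \<open>\<omega>\<close>,
  restricted to \<open>A\<close>. It is 0 where that preimage is not measurable; for a process on a Fubini
  extension this happens only for \<open>\<omega>\<close> in a null set.
\<close>

definition coalition_share ::
    "'i measure \<Rightarrow> ('i \<times> 'w \<Rightarrow> 'x) \<Rightarrow> 'i set \<Rightarrow> 'x set \<Rightarrow> 'w \<Rightarrow> real" where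
  "coalition_share L f A B \<omega> = measure L {i \<in> A. f (i, \<omega>) \<in> B}"

definition aggregate_algebra ::
    "'i measure \<Rightarrow> 'w measure \<Rightarrow> ('i \<times> 'w \<Rightarrow> 'x::topological_space) \<Rightarrow> 'w measure" where
  "aggregate_algebra L P f =
     generated_with_null_sets P
       {coalition_share L f A B -` D \<inter> space P | A B D.
          A \<in> sets L \<and> B \<in> sets borel \<and> D \<in> sets borel}"

definition cond_probability :: "'a measure \<Rightarrow> 'a measure \<Rightarrow> 'a set \<Rightarrow> 'a \<Rightarrow> real" where
  "cond_probability M F E = real_cond_exp M F (indicator E)"

definition regular_cond_distribution ::
    "'a measure \<Rightarrow> 'a measure \<Rightarrow> ('a \<Rightarrow> 'x::topological_space) \<Rightarrow> ('a \<Rightarrow> 'x measure) \<Rightarrow> bool" where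
  "regular_cond_distribution M F f \<mu> \<longleftrightarrow>
     \<mu> \<in> F \<rightarrow>\<^sub>M prob_algebra borel \<and>
     (\<forall>B\<in>sets borel. AE x in M. measure (\<mu> x) B = cond_probability M F (f -` B \<inter> space M) x)"

text \<open>
  Regular conditional distributions of maps to a Polish space exist and any two agree almost
  everywhere, so the property does not depend on the version \<open>\<mu>\<close>; it is required of every version.
\<close>

definition no_coalitional_individual_uncertainty ::
    "'i measure \<Rightarrow> 'w measure \<Rightarrow> ('i \<times> 'w) measure \<Rightarrow> ('i \<times> 'w \<Rightarrow> 'x::polish_space) \<Rightarrow>
     'w measure \<Rightarrow> bool" where
  "no_coalitional_individual_uncertainty L P Q f C \<longleftrightarrow>
     (\<forall>\<mu>. regular_cond_distribution Q (L \<Otimes>\<^sub>M C) f \<mu> \<longrightarrow>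
        (\<forall>A\<in>sets L. AE \<omega> in P. \<forall>B\<in>sets borel.
           coalition_share L f A B \<omega> = (LINT i:A|L. measure (\<mu> (i, \<omega>)) B)))"

definition cond_independent ::
    "'w measure \<Rightarrow> 'w measure \<Rightarrow> ('w \<Rightarrow> 'x::topological_space) \<Rightarrow> ('w \<Rightarrow> 'x) \<Rightarrow> bool" where
  "cond_independent P C \<phi> \<psi> \<longleftrightarrow>
     \<phi> \<in> borel_measurable P \<and> \<psi> \<in> borel_measurable P \<and>
     (\<forall>B1\<in>sets borel. \<forall>B2\<in>sets borel. AE \<omega> in P.
        cond_probability P C ((\<phi> -` B1 \<inter> space P) \<inter> (\<psi> -` B2 \<inter> space P)) \<omega> =
        cond_probability P C (\<phi> -` B1 \<inter> space P) \<omega> *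
        cond_probability P C (\<psi> -` B2 \<inter> space P) \<omega>)"

definition essentially_pairwise_cond_independent ::
    "'i measure \<Rightarrow> 'w measure \<Rightarrow> 'w measure \<Rightarrow> ('i \<times> 'w \<Rightarrow> 'x::topological_space) \<Rightarrow> bool" where
  "essentially_pairwise_cond_independent L P C f \<longleftrightarrow>
     (AE i1 in L. AE i2 in L.
        cond_independent P C (\<lambda>\<omega>. f (i1, \<omega>)) (\<lambda>\<omega>. f (i2, \<omega>)))"

end

theory Submission
  imports Defs
begin

text \<open>
  Integrating the event \<open>f \<in> B\<close> over \<open>A \<times> D\<close> in either order shows that the share \<open>X\<^sup>A\<close> of \<open>B\<close> in the
  coalition \<open>A\<close> satisfies \<open>X\<^sup>A = \<integral>\<^sub>A h(i,\<cdot>) dL\<close> whenever \<open>h\<close> is the conditional expectation of the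
  event given \<open>L \<Otimes> C\<close> and \<open>X\<^sup>A\<close> is \<open>C\<close>-measurable. With \<open>C\<close> all of \<open>P\<close>, the function \<open>h\<close> is product
  measurable, so only countably many sets \<open>A\<close> enter into it, and the shares of these generate all
  the others. With \<open>C\<close> the aggregate algebra this is (2), and it makes \<open>h\<close> also the conditional
  expectation given \<open>L \<Otimes> P\<close>. Hence \<open>P(f\<^sub>j \<in> B, E) = \<integral>\<^sub>E h(j,\<cdot>) dP\<close> for almost all \<open>j\<close>, simultaneously for all \<open>E\<close>
  in a countable family generating \<open>C\<close> and \<open>f\<^sub>i\<close>, which is conditional independence of \<open>f\<^sub>i\<close> and \<open>f\<^sub>j\<close>.
\<close>

section \<open>Countable intersection-stable generators\<close>

text \<open>A countable family has only countably many finite subfamilies, hence countably many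
  finite intersections. Cutting with \<open>space M\<close> lets the empty subfamily contribute the
  whole space.\<close>

lemma countable_Int_stable_superset:
  assumes "countable G" and "G \<subseteq> sets M"
  obtains H where "countable H" and "G \<subseteq> H" and "H \<subseteq> sets M" and "Int_stable H" and "space M \<in> H"
proof
  let ?H = "(\<lambda>F. space M \<inter> \<Inter>F) ` {F. finite F \<and> F \<subseteq> G}"
  show "countable ?H"
    by (intro countable_image countable_Collect_finite_subset assms)
  show "G \<subseteq> ?H"
  proof
    fix A assume "A \<in> G"
    moreover from this have "A = space M \<inter> \<Inter>{A}"
      using assms(2) sets.sets_into_space by auto
    ultimately show "A \<in> ?H"
      by blast
  qed
  show "?H \<subseteq> sets M"
  proof clarify
    fix F assume "finite F" "F \<subseteq> G"
    then show "space M \<inter> \<Inter>F \<in> sets M"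
    proof (induction F)
      case (insert A F)
      have "space M \<inter> \<Inter>(insert A F) = A \<inter> (space M \<inter> \<Inter>F)" by auto
      with insert assms(2) show ?case by (auto intro: sets.Int)
    qed simp
  qed
  show "Int_stable ?H"
  proof (rule Int_stableI)
    fix A B assume "A \<in> ?H" "B \<in> ?H"
    then obtain F F' where "A = space M \<inter> \<Inter>F" "B = space M \<inter> \<Inter>F'"
      and "finite F" "finite F'" "F \<subseteq> G" "F' \<subseteq> G"
      by auto
    then have "A \<inter> B = space M \<inter> \<Inter>(F \<union> F')" and "F \<union> F' \<in> {F. finite F \<and> F \<subseteq> G}"
      by auto
    then show "A \<inter> B \<in> ?H" by blast
  qed
  have "space M \<inter> \<Inter>{} = space M" by simp
  then show "space M \<in> ?H" by blast
qed

text \<open>Almost-everywhere statements about all Borel sets are tested on \<open>H\<close>: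
  countability lets the exceptional null sets be merged, and stability under intersection permits
  Dynkin-type uniqueness arguments.\<close>

lemma borel_countable_Int_stable_generator:
  obtains H :: "'x::second_countable_topology set set"
  where "countable H" and "Int_stable H" and "UNIV \<in> H" and "H \<subseteq> sets borel"
    and "sets borel = sigma_sets UNIV H"
proof -
  obtain G :: "'x set set" where G: "countable G" "topological_basis G"
    using ex_countable_basis by blast
  have borel: "(borel :: 'x measure) = sigma UNIV G"
    using G by (rule borel_eq_countable_basis)
  then have "G \<subseteq> sets borel" by (metis sets_measure_of sigma_sets_superset_generator subset_UNIV Pow_UNIV)
  with G(1) obtain H where H: "countable H" "G \<subseteq> H" "H \<subseteq> sets (borel :: 'x measure)"
      "Int_stable H" "space (borel :: 'x measure) \<in> H"
    by (rule countable_Int_stable_superset)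
  have "sets borel = sigma_sets UNIV G"
    unfolding borel by (rule sets_measure_of) simp
  also have "\<dots> \<subseteq> sigma_sets UNIV H"
    using H(2) by (rule sigma_sets_mono')
  finally have "sets borel \<subseteq> sigma_sets UNIV H" .
  moreover have "sigma_sets UNIV H \<subseteq> sets borel"
    using H(3) by (metis sets.sigma_sets_subset space_borel)
  ultimately show thesis
    using H that by auto
qed

section \<open>Vanishing integrals, conditional expectations and null sets\<close>

text \<open>A Dynkin argument. Adjoining the null sets keeps the family stable under intersection,
  because a null set cut with a measurable set is null; \<open>space M \<in> H\<close> handles
  complements.\<close>

lemma set_integral_eq_0_sigma_sets:
  fixes k :: "'a \<Rightarrow> real"
  assumes k: "integrable M k"
    and H: "Int_stable H" "H \<subseteq> sets M" "space M \<in> H"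
    and eq_0: "\<And>A. A \<in> H \<Longrightarrow> (LINT x:A|M. k x) = 0"
    and A: "A \<in> sigma_sets (space M) (H \<union> null_sets M)"
  shows "(LINT x:A|M. k x) = 0"
proof -
  have null: "(LINT x:N|M. k x) = 0" if "N \<in> null_sets M" for N
    using AE_not_in[OF that] unfolding set_lebesgue_integral_def
    by (intro integral_eq_zero_AE) (auto elim: eventually_mono)
  have int: "set_integrable M A k" if "A \<in> sets M" for A
    using k that unfolding set_integrable_def by (intro integrable_mult_indicator)
  have sub: "H \<union> null_sets M \<subseteq> sets M"
    using H(2) by auto
  have sets: "B \<in> sets M" if "B \<in> sigma_sets (space M) (H \<union> null_sets M)" for B
    using that sub sets.sigma_sets_subset by blast
  have "Int_stable (H \<union> null_sets M)"
    using H(1,2) by (auto simp: Int_stable_def intro: null_set_Int1 null_set_Int2)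
  moreover have "H \<union> null_sets M \<subseteq> Pow (space M)"
    using sub sets.sets_into_space by auto
  ultimately show ?thesis
    using A
  proof (induction rule: sigma_sets_induct_disjoint)
    case (basic A)
    then show ?case using eq_0 null by blast
  next
    case empty
    then show ?case by (simp add: set_lebesgue_integral_def)
  next
    case (compl A)
    have "(LINT x:space M|M. k x) = (LINT x:(space M - A) \<union> A|M. k x)"
      using sets[OF compl(1)] sets.sets_into_space by (intro arg_cong2[where f="\<lambda>A. set_lebesgue_integral M A"]) auto
    also have "\<dots> = (LINT x:space M - A|M. k x) + (LINT x:A|M. k x)"
      using sets[OF compl(1)] by (intro set_integral_Un int) auto
    finally show ?case
      using compl(2) eq_0[OF H(3)] by simp
  next
    case (union A)
    then have "(LINT x:(\<Union>i. A i)|M. k x) = (\<Sum>i. (LINT x:(A i)|M. k x))"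
      using sets[of "A _"] by (intro lebesgue_integral_countable_add int sets.countable_UN)
        (auto simp: disjoint_family_on_def range_subsetD)
    then show ?case
      using union by simp
  qed
qed

text \<open>Preimages under \<open>u\<close> and \<open>v\<close> differ only inside a null set
  \<open>N\<close>. By completeness every subset of \<open>N\<close> is a null set and so belongs to
  \<open>F\<close>.\<close>

lemma measurable_cong_AE_complete:
  fixes u v :: "'a \<Rightarrow> 'b::topological_space"
  assumes "complete_measure M" and sub: "subalgebra M F" and null: "null_sets M \<subseteq> sets F"
    and u: "u \<in> borel_measurable F" and AE: "AE x in M. u x = v x"
  shows "v \<in> borel_measurable F"
proof (rule measurableI)
  interpret complete_measure M by fact
  fix U :: "'b set" assume U: "U \<in> sets borel"
  from AE obtain N where N: "{x \<in> space M. u x \<noteq> v x} \<subseteq> N" "N \<in> null_sets M"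
    by (auto simp: eventually_ae_filter)
  have "N \<inter> (v -` U \<inter> space F) \<in> null_sets M"
    using N(2) by (rule complete2[rotated]) auto
  moreover have "u -` U \<inter> space F \<in> sets F"
    using u U by (rule measurable_sets)
  moreover have "v -` U \<inter> space F = (u -` U \<inter> space F - N) \<union> (N \<inter> (v -` U \<inter> space F))"
    using N(1) sub unfolding subalgebra_def by auto
  ultimately show "v -` U \<inter> space F \<in> sets F"
    using null N(2) by (metis in_mono sets.Diff sets.Un)
qed auto

lemma integrable_bounded_mult:
  fixes y d :: "'a \<Rightarrow> real"
  assumes y: "integrable M y" and d: "d \<in> borel_measurable M" and bound: "AE x in M. \<bar>d x\<bar> \<le> 1"
  shows "integrable M (\<lambda>x. d x * y x)"
proof (rule Bochner_Integration.integrable_bound[OF y])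
  show "(\<lambda>x. d x * y x) \<in> borel_measurable M"
    using d borel_measurable_integrable[OF y] by simp
  show "AE x in M. norm (d x * y x) \<le> norm (y x)"
    using bound by eventually_elim (simp add: abs_mult mult_left_le_one_le)
qed

lemma (in prob_space) cond_exp_indicator:
  assumes sub: "subalgebra M F" and D: "D \<in> sets M"
  shows "AE x in M. \<bar>real_cond_exp M F (indicator D) x\<bar> \<le> 1"
    and "integrable M (real_cond_exp M F (indicator D))"
    and "integrable M (indicator D :: 'a \<Rightarrow> real)"
proof -
  interpret finite_measure_subalgebra M F
    by unfold_locales (rule sub)
  show iD: "integrable M (indicator D :: 'a \<Rightarrow> real)"
    using D by (simp add: emeasure_eq_measure)
  show "AE x in M. \<bar>real_cond_exp M F (indicator D) x\<bar> \<le> 1"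
    using real_cond_exp_ge_c[OF iD, of 0] real_cond_exp_le_c[OF iD, of 1] by auto
  show "integrable M (real_cond_exp M F (indicator D))"
    using iD by (rule real_cond_exp_int)
qed

text \<open>Conditional expectation is self-adjoint, so it can be moved from the indicator of
  \<open>D\<close> to \<open>x\<close>. The pairing hypothesis then gives \<open>x\<close> and its
  conditional expectation the same integral over every \<open>D\<close>. They agree almost
  everywhere, and completeness makes \<open>x\<close> itself \<open>F\<close>-measurable.\<close>

lemma measurable_if_cond_exp_pairing:
  assumes "prob_space M" "complete_measure M" and sub: "subalgebra M F" and null: "null_sets M \<subseteq> sets F"
    and x: "integrable M x"
    and pairing: "\<And>D. D \<in> sets M \<Longrightarrow>
      (\<integral>w. (indicator D w - real_cond_exp M F (indicator D) w) * x w \<partial>M) = (0::real)"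
  shows "x \<in> borel_measurable F"
proof -
  interpret prob_space M by fact
  interpret finite_measure_subalgebra M F
    by unfold_locales (rule sub)
  let ?x = "real_cond_exp M F x"
  have "AE w in M. ?x w = x w"
  proof (rule density_unique_real)
    show "integrable M ?x" using x by (rule real_cond_exp_int)
    show "integrable M x" by fact
    fix D assume D[measurable]: "D \<in> sets M"
    let ?d = "real_cond_exp M F (indicator D)"
    have int_d: "integrable M (\<lambda>w. ?d w * y w)" if "integrable M y" for y
      using that cond_exp_indicator[OF sub D]
      by (intro integrable_bounded_mult borel_measurable_integrable)
    have int_D: "integrable M (\<lambda>w. indicator D w * y w)" if "integrable M y" for y :: "_ \<Rightarrow> real"
      using integrable_mult_indicator[OF D that] by simp
    have "(LINT w:D|M. x w) = (\<integral>w. ?d w * x w \<partial>M)"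
      using pairing[OF D] int_d[OF x] int_D[OF x]
      by (simp add: set_lebesgue_integral_def left_diff_distrib)
    also have "\<dots> = (\<integral>w. ?d w * ?x w \<partial>M)"
      using x int_d[OF x] by (intro real_cond_exp_intg(2)[symmetric]) auto
    also have "\<dots> = (\<integral>w. ?x w * ?d w \<partial>M)"
      by (simp add: mult.commute)
    also have "\<dots> = (\<integral>w. ?x w * indicator D w \<partial>M)"
      using int_D[OF real_cond_exp_int(1)[OF x]] by (intro real_cond_exp_intg(2)) (auto simp: mult.commute)
    finally show "(LINT w:D|M. ?x w) = (LINT w:D|M. x w)"
      by (simp add: set_lebesgue_integral_def mult.commute)
  qed
  then show ?thesis
    using measurable_cong_AE_complete[OF assms(2) sub null borel_measurable_cond_exp] by blast
qed

section \<open>Product measurability with countably many left factors\<close>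

lemma subalgebra_pair_measure:
  assumes "subalgebra M F" and "subalgebra N G"
  shows "subalgebra (M \<Otimes>\<^sub>M N) (F \<Otimes>\<^sub>M G)"
proof -
  have "{a \<times> b |a b. a \<in> sets F \<and> b \<in> sets G} \<subseteq> {a \<times> b |a b. a \<in> sets M \<and> b \<in> sets N}"
    using assms unfolding subalgebra_def by blast
  then show ?thesis
    using assms unfolding subalgebra_def sets_pair_measure space_pair_measure
    by (simp add: sigma_sets_mono')
qed

lemma sets_pair_sigma_mono:
  assumes "G \<subseteq> H" and "H \<subseteq> Pow S"
  shows "sets (sigma S G \<Otimes>\<^sub>M N) \<subseteq> sets (sigma S H \<Otimes>\<^sub>M N)"
proof -
  have "sigma_sets S G \<subseteq> sigma_sets S H"
    using assms(1) by (rule sigma_sets_mono')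
  moreover have "G \<subseteq> Pow S"
    using assms by (rule order_trans)
  ultimately have "subalgebra (sigma S H) (sigma S G)"
    using assms(2) by (simp add: subalgebra_def sets_measure_of space_measure_of_conv)
  moreover have "subalgebra N N"
    by (simp add: subalgebra_def)
  ultimately show ?thesis
    using subalgebra_pair_measure unfolding subalgebra_def[of "_ \<Otimes>\<^sub>M _"] by blast
qed

text \<open>Induction over the generation of \<open>E\<close>: a rectangle uses one set of
  \<open>M\<close>, a complement the same family, and a countable union the union of the families of
  its members.\<close>

lemma sets_pair_measure_countable_left:
  assumes "E \<in> sets (M \<Otimes>\<^sub>M N)"
  obtains G where "countable G" and "G \<subseteq> sets M" and "E \<in> sets (sigma (space M) G \<Otimes>\<^sub>M N)"
proof -
  have "E \<in> sigma_sets (space M \<times> space N) {a \<times> b |a b. a \<in> sets M \<and> b \<in> sets N}"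
    using assms by (simp only: sets_pair_measure)
  then have "\<exists>G. countable G \<and> G \<subseteq> sets M \<and> E \<in> sets (sigma (space M) G \<Otimes>\<^sub>M N)"
  proof (induction rule: sigma_sets.induct)
    case (Basic E)
    then obtain A B where E: "E = A \<times> B" "A \<in> sets M" "B \<in> sets N" by auto
    then have "A \<in> sets (sigma (space M) {A})"
      using sets.sets_into_space by (subst sets_measure_of) auto
    with E show ?case
      by (intro exI[of _ "{A}"]) simp
  next
    case Empty
    then show ?case by (intro exI[of _ "{}"]) simp
  next
    case (Compl E)
    then obtain G where G: "countable G" "G \<subseteq> sets M" "E \<in> sets (sigma (space M) G \<Otimes>\<^sub>M N)"
      by blast
    have "space (sigma (space M) G \<Otimes>\<^sub>M N) - E \<in> sets (sigma (space M) G \<Otimes>\<^sub>M N)"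
      using G(3) by (rule sets.compl_sets)
    then have "space M \<times> space N - E \<in> sets (sigma (space M) G \<Otimes>\<^sub>M N)"
      by (simp add: space_pair_measure space_measure_of_conv)
    then show ?case
      using G by blast
  next
    case (Union E)
    from Union.IH obtain G where G: "\<And>n. countable (G n)" "\<And>n. G n \<subseteq> sets M"
        "\<And>n. E n \<in> sets (sigma (space M) (G n) \<Otimes>\<^sub>M N)"
      by metis
    have sub: "(\<Union>n. G n) \<subseteq> Pow (space M)"
      using G(2) sets.sets_into_space by blast
    have "E n \<in> sets (sigma (space M) (\<Union>n. G n) \<Otimes>\<^sub>M N)" for n
      using sets_pair_sigma_mono[OF _ sub, of "G n" N] G(3) by blast
    then have "(\<Union>n. E n) \<in> sets (sigma (space M) (\<Union>n. G n) \<Otimes>\<^sub>M N)"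
      by (intro sets.countable_UN) auto
    moreover have "countable (\<Union>n. G n)" "(\<Union>n. G n) \<subseteq> sets M"
      using G by auto
    ultimately show ?case by blast
  qed
  with that show thesis by blast
qed

text \<open>The preimage of each member of a countable Borel generator needs countably many left
  factors; the union of these families serves for \<open>h\<close>.\<close>

lemma borel_measurable_pair_countable_left:
  fixes h :: "'a \<times> 'b \<Rightarrow> 'c::second_countable_topology"
  assumes h: "h \<in> borel_measurable (M \<Otimes>\<^sub>M N)"
  obtains G where "countable G" and "G \<subseteq> sets M" and "h \<in> borel_measurable (sigma (space M) G \<Otimes>\<^sub>M N)"
proof -
  obtain H :: "'c set set" where H: "countable H" "H \<subseteq> sets borel" "sets borel = sigma_sets UNIV H"
    using borel_countable_Int_stable_generator by metis
  have "\<exists>G. countable G \<and> G \<subseteq> sets M \<and> h -` U \<inter> space (M \<Otimes>\<^sub>M N) \<in> sets (sigma (space M) G \<Otimes>\<^sub>M N)"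
    if "U \<in> H" for U
  proof -
    have "h -` U \<inter> space (M \<Otimes>\<^sub>M N) \<in> sets (M \<Otimes>\<^sub>M N)"
      using that H(2) by (intro measurable_sets[OF h]) blast
    then obtain G where "countable G" "G \<subseteq> sets M"
        "h -` U \<inter> space (M \<Otimes>\<^sub>M N) \<in> sets (sigma (space M) G \<Otimes>\<^sub>M N)"
      by (rule sets_pair_measure_countable_left)
    then show ?thesis
      by blast
  qed
  then have "\<forall>U\<in>H. \<exists>G. countable G \<and> G \<subseteq> sets M \<and>
      h -` U \<inter> space (M \<Otimes>\<^sub>M N) \<in> sets (sigma (space M) G \<Otimes>\<^sub>M N)"
    by (rule ballI)
  then obtain G where G: "\<forall>U\<in>H. countable (G U) \<and> G U \<subseteq> sets M \<and>
      h -` U \<inter> space (M \<Otimes>\<^sub>M N) \<in> sets (sigma (space M) (G U) \<Otimes>\<^sub>M N)"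
    by (rule bchoice[THEN exE])
  let ?G = "\<Union>U\<in>H. G U"
  have "h \<in> borel_measurable (sigma (space M) ?G \<Otimes>\<^sub>M N)"
  proof (rule measurable_sigma_sets[OF H(3) subset_UNIV[of H, folded Pow_UNIV]])
    fix U assume U: "U \<in> H"
    have "G U \<subseteq> ?G" "?G \<subseteq> Pow (space M)"
      using G U sets.sets_into_space by blast+
    then have "sets (sigma (space M) (G U) \<Otimes>\<^sub>M N) \<subseteq> sets (sigma (space M) ?G \<Otimes>\<^sub>M N)"
      by (rule sets_pair_sigma_mono)
    moreover have "h -` U \<inter> space (M \<Otimes>\<^sub>M N) \<in> sets (sigma (space M) (G U) \<Otimes>\<^sub>M N)"
      using G U by blast
    moreover have "space (sigma (space M) ?G \<Otimes>\<^sub>M N) = space (M \<Otimes>\<^sub>M N)"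
      by (simp add: space_pair_measure space_measure_of_conv)
    ultimately show "h -` U \<inter> space (sigma (space M) ?G \<Otimes>\<^sub>M N) \<in> sets (sigma (space M) ?G \<Otimes>\<^sub>M N)"
      by auto
  qed simp
  moreover have "countable ?G" "?G \<subseteq> sets M"
    using G H(1) by auto
  ultimately show thesis
    using that by blast
qed

section \<open>Sigma-algebras generated together with the null sets\<close>

lemma sets_generated_with_null_sets:
  assumes "G \<subseteq> sets P"
  shows "sets (generated_with_null_sets P G) = sigma_sets (space P) (G \<union> null_sets P)"
proof -
  have "G \<union> null_sets P \<subseteq> Pow (space P)"
    using assms sets.sets_into_space by blast
  then show ?thesis
    unfolding generated_with_null_sets_def by (rule sets_measure_of)
qed

lemma subalgebra_generated_with_null_sets:
  assumes "G \<subseteq> sets P"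
  shows "subalgebra P (generated_with_null_sets P G)"
proof -
  have "G \<union> null_sets P \<subseteq> sets P"
    using assms by auto
  then have "sigma_sets (space P) (G \<union> null_sets P) \<subseteq> sets P"
    by (rule sets.sigma_sets_subset)
  then show ?thesis
    using sets_generated_with_null_sets[OF assms]
    by (simp add: subalgebra_def generated_with_null_sets_def space_measure_of_conv)
qed

section \<open>A criterion for conditional independence\<close>

text \<open>
  It suffices to test \<open>\<psi>\<close> on a generator. The hypothesis says that \<open>u B\<close> is the conditional probability
  of \<open>\<psi>\<^sup>-\<^sup>1 B\<close> given the \<open>\<sigma>\<close>-algebra generated by \<open>C\<close> and \<open>\<phi>\<close>, although it is \<open>C\<close>-measurable.
\<close>

lemma cond_independentI:
  fixes \<phi> \<psi> :: "'w \<Rightarrow> 'x::topological_space"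
  assumes "prob_space P" and sub: "subalgebra P C"
    and \<phi>[measurable]: "\<phi> \<in> borel_measurable P" and \<psi>[measurable]: "\<psi> \<in> borel_measurable P"
    and H: "Int_stable H" "UNIV \<in> H" "H \<subseteq> sets borel" "sets borel = sigma_sets UNIV H"
    and u: "\<And>B. B \<in> H \<Longrightarrow> u B \<in> borel_measurable C" "\<And>B. B \<in> H \<Longrightarrow> integrable P (u B)"
    and eq: "\<And>D B1 B2. D \<in> sets C \<Longrightarrow> B1 \<in> sets borel \<Longrightarrow> B2 \<in> H \<Longrightarrow>
      measure P (D \<inter> (\<phi> -` B1 \<inter> space P) \<inter> (\<psi> -` B2 \<inter> space P)) =
      (LINT w:D \<inter> (\<phi> -` B1 \<inter> space P)|P. u B2 w)"
  shows "cond_independent P C \<phi> \<psi>"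
  unfolding cond_independent_def
proof (intro conjI ballI \<phi> \<psi>)
  interpret prob_space P by fact
  interpret finite_measure_subalgebra P C
    by unfold_locales (rule sub)
  fix B1 B2 :: "'x set" assume B1[measurable]: "B1 \<in> sets borel" and B2: "B2 \<in> sets borel"
  let ?E = "\<lambda>A. real_cond_exp P C (indicator A)"
  define X where "X = \<phi> -` B1 \<inter> space P"
  define Y where "Y B = \<psi> -` B \<inter> space P" for B
  have X: "X \<in> sets P"
    unfolding X_def by measurable
  have Y: "Y B \<in> sets P" if "B \<in> sets borel" for B
    using \<psi> that unfolding Y_def by (rule measurable_sets)
  have C_P: "D \<in> sets P" if "D \<in> sets C" for D
    using sub that unfolding subalgebra_def by blast
  have Em: "?E A \<in> borel_measurable P" for A
    using sub borel_measurable_cond_exp by (rule measurable_from_subalg)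
  have int_E: "integrable P (\<lambda>w. ?E A w * y w)" if "integrable P y" "A \<in> sets P" for A y
    using that Em cond_exp_indicator(1)[OF sub] by (intro integrable_bounded_mult)
  have int_I: "integrable P (\<lambda>w. indicator A w * y w)" if "integrable P y" "A \<in> sets P" for A and y :: "_ \<Rightarrow> real"
    using integrable_mult_indicator[OF that(2,1)] by simp
  have int_1: "integrable P (indicator A :: _ \<Rightarrow> real)" if "A \<in> sets P" for A
    using cond_exp_indicator(3)[OF sub that] .
  \<comment> \<open>The product of \<open>indicator D\<close> and \<open>?E A\<close> is
    \<open>C\<close>-measurable, so \<open>A'\<close> may be exchanged for its conditional
    probability. Used in both directions, this moves the conditioning from one of two events to the
    other.\<close>
  have swap: "(\<integral>w. indicator D w * ?E A w * indicator A' w \<partial>P) = (\<integral>w. indicator D w * ?E A w * ?E A' w \<partial>P)"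
    if "D \<in> sets C" "A \<in> sets P" "A' \<in> sets P" for D A A'
  proof (rule real_cond_exp_intg(2)[symmetric])
    show "integrable P (\<lambda>w. indicator D w * ?E A w * indicator A' w)"
      using int_I[OF int_E[OF int_1[OF that(3)] that(2)] C_P[OF that(1)]] by (simp add: mult.assoc)
    show "(\<lambda>w. indicator D w * ?E A w) \<in> borel_measurable C"
      using that(1) by (intro borel_measurable_times borel_measurable_indicator borel_measurable_cond_exp)
    show "indicator A' \<in> borel_measurable P"
      using that(3) by simp
  qed
  \<comment> \<open>The choice \<open>B1 = UNIV\<close> in \<open>eq\<close> identifies
    \<open>u B\<close> as a version of the conditional probability of \<open>Y B\<close> given
    \<open>C\<close>.\<close>
  have u_eq: "AE w in P. ?E (Y B) w = u B w" if B: "B \<in> H" for B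
  proof (rule real_cond_exp_charact)
    fix D assume D: "D \<in> sets C"
    have "(LINT w:D|P. indicator (Y B) w) = measure P (D \<inter> Y B)"
      using C_P[OF D] Y H(3) B sets.sets_into_space[OF C_P[OF D]]
      by (simp add: set_lebesgue_integral_def indicator_inter_arith[symmetric] Int_absorb2 inf_assoc)
        (metis Int_assoc Int_commute inf.absorb_iff2)
    also have "\<dots> = (LINT w:D|P. u B w)"
      using eq[OF D _ B, of UNIV] sets.sets_into_space[OF C_P[OF D]] by (simp add: Y_def Int_absorb2)
    finally show "(LINT w:D|P. indicator (Y B) w) = (LINT w:D|P. u B w)" .
  qed (use u B H(3) Y int_1 in auto)
  \<comment> \<open>The difference of the two sides is the integral of \<open>?k\<close> over
    \<open>Y B2\<close>. This vanishes for members of \<open>H\<close> and hence, their preimages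
    being an intersection-stable generator, for every Borel set.\<close>
  have joint: "measure P (D \<inter> X \<inter> Y B2) = (\<integral>w. indicator D w * ?E X w * indicator (Y B2) w \<partial>P)"
    if D: "D \<in> sets C" for D
  proof -
    let ?k = "\<lambda>w. indicator (D \<inter> X) w - indicator D w * ?E X w"
    have DX: "D \<inter> X \<in> sets P"
      using C_P[OF D] X by blast
    have int: "integrable P (\<lambda>w. indicator D w * ?E X w)"
      using int_I[OF cond_exp_indicator(2)[OF sub X] C_P[OF D]] .
    have split: "(LINT w:Y B|P. ?k w) =
        measure P (D \<inter> X \<inter> Y B) - (\<integral>w. indicator D w * ?E X w * indicator (Y B) w \<partial>P)"
      if "B \<in> sets borel" for B
    proof -
      have "(LINT w:Y B|P. ?k w) =
          (\<integral>w. indicator (D \<inter> X \<inter> Y B) w - indicator D w * ?E X w * indicator (Y B) w \<partial>P)"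
        unfolding set_lebesgue_integral_def
        by (intro Bochner_Integration.integral_cong) (auto simp: indicator_def)
      also have "\<dots> = (\<integral>w. indicator (D \<inter> X \<inter> Y B) w \<partial>P) - (\<integral>w. indicator D w * ?E X w * indicator (Y B) w \<partial>P)"
        using int_1[OF sets.Int[OF DX Y[OF that]]] int_I[OF int Y[OF that]]
        by (intro Bochner_Integration.integral_diff) (auto simp: ac_simps)
      finally show ?thesis
        using sets.sets_into_space[OF DX] by (simp add: Int_absorb2 le_infI1)
    qed
    have "(LINT w:Y B2|P. ?k w) = 0"
    proof (rule set_integral_eq_0_sigma_sets)
      let ?H = "{\<psi> -` B \<inter> space P | B. B \<in> H}"
      show "integrable P ?k"
        using int_1[OF DX] int by (intro Bochner_Integration.integrable_diff)
      show "Int_stable ?H"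
      proof (rule Int_stableI)
        fix a b assume "a \<in> ?H" "b \<in> ?H"
        then obtain A B where "a = \<psi> -` A \<inter> space P" "b = \<psi> -` B \<inter> space P" "A \<in> H" "B \<in> H"
          by blast
        then have "a \<inter> b = \<psi> -` (A \<inter> B) \<inter> space P" "A \<inter> B \<in> H"
          using H(1) by (auto simp: Int_stable_def)
        then show "a \<inter> b \<in> ?H" by blast
      qed
      show "?H \<subseteq> sets P"
        using Y H(3) unfolding Y_def by blast
      show "space P \<in> ?H"
        using H(2) by (auto intro!: exI[of _ UNIV])
      have "Y B2 \<in> {\<psi> -` B \<inter> space P | B. B \<in> sigma_sets UNIV H}"
        using B2 H(4) unfolding Y_def by blast
      then have "Y B2 \<in> sigma_sets (space P) ?H"
        by (simp add: sigma_sets_vimage_commute)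
      then show "Y B2 \<in> sigma_sets (space P) (?H \<union> null_sets P)"
        using sigma_sets_mono'[of ?H "?H \<union> null_sets P" "space P"] by blast
      fix A assume "A \<in> ?H"
      then obtain B where B: "B \<in> H" "A = Y B"
        unfolding Y_def by blast
      then have Bb: "B \<in> sets borel"
        using H(3) by blast
      \<comment> \<open>After \<open>u B\<close> is replaced by the conditional probability of
        \<open>Y B\<close>, two uses of \<open>swap\<close> carry the conditioning from
        \<open>Y B\<close> to \<open>X\<close> by way of the product of both conditional
        probabilities.\<close>
      have "measure P (D \<inter> X \<inter> Y B) = (\<integral>w. indicator (D \<inter> X) w * u B w \<partial>P)"
        using eq[OF D B1 B(1)] by (simp add: X_def Y_def set_lebesgue_integral_def)
      also have "\<dots> = (\<integral>w. indicator D w * ?E (Y B) w * indicator X w \<partial>P)"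
      proof (rule integral_cong_AE)
        show "AE w in P. indicator (D \<inter> X) w * u B w = indicator D w * ?E (Y B) w * indicator X w"
          using u_eq[OF B(1)] by eventually_elim (auto simp: indicator_def)
      qed (use DX X C_P[OF D] Em measurable_from_subalg[OF sub u(1)[OF B(1)]] in auto)
      also have "\<dots> = (\<integral>w. indicator D w * ?E (Y B) w * ?E X w \<partial>P)"
        using D Y[OF Bb] X by (rule swap)
      also have "\<dots> = (\<integral>w. indicator D w * ?E X w * ?E (Y B) w \<partial>P)"
        by (simp add: ac_simps)
      also have "\<dots> = (\<integral>w. indicator D w * ?E X w * indicator (Y B) w \<partial>P)"
        using D X Y[OF Bb] by (rule swap[symmetric])
      finally show "(LINT w:A|P. ?k w) = 0"
        using split[OF Bb] B by simp
    qed
    then show ?thesis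
      using split[OF B2] by simp
  qed
  \<comment> \<open>The product is \<open>C\<close>-measurable and has the right integral over each
    \<open>D \<in> sets C\<close>: \<open>joint\<close> conditions \<open>X\<close>, and
    \<open>swap\<close> then conditions \<open>Y B2\<close>.\<close>
  have "AE w in P. ?E (X \<inter> Y B2) w = ?E X w * ?E (Y B2) w"
  proof (rule real_cond_exp_charact)
    show "integrable P (indicator (X \<inter> Y B2) :: _ \<Rightarrow> real)"
      using X Y[OF B2] by (intro int_1) auto
    show "integrable P (\<lambda>w. ?E X w * ?E (Y B2) w)"
      using cond_exp_indicator(2)[OF sub Y[OF B2]] X by (rule int_E)
    show "(\<lambda>w. ?E X w * ?E (Y B2) w) \<in> borel_measurable C"
      by (intro borel_measurable_times borel_measurable_cond_exp)
    fix D assume D: "D \<in> sets C"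
    have "(LINT w:D|P. indicator (X \<inter> Y B2) w) = (\<integral>w. indicator (D \<inter> X \<inter> Y B2) w \<partial>P)"
      unfolding set_lebesgue_integral_def
      by (intro Bochner_Integration.integral_cong) (auto simp: indicator_def)
    also have "\<dots> = measure P (D \<inter> X \<inter> Y B2)"
      using sets.sets_into_space[OF X] by (simp add: Int_absorb2 le_infI1 le_infI2)
    also have "\<dots> = (\<integral>w. indicator D w * ?E X w * indicator (Y B2) w \<partial>P)"
      using D by (rule joint)
    also have "\<dots> = (\<integral>w. indicator D w * ?E X w * ?E (Y B2) w \<partial>P)"
      using D X Y[OF B2] by (rule swap)
    finally show "(LINT w:D|P. indicator (X \<inter> Y B2) w) = (LINT w:D|P. ?E X w * ?E (Y B2) w)"
      by (simp add: set_lebesgue_integral_def mult.assoc)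
  qed
  then show "AE w in P. cond_probability P C ((\<phi> -` B1 \<inter> space P) \<inter> (\<psi> -` B2 \<inter> space P)) w =
      cond_probability P C (\<phi> -` B1 \<inter> space P) w * cond_probability P C (\<psi> -` B2 \<inter> space P) w"
    by (simp add: cond_probability_def X_def Y_def)
qed

section \<open>Fubini extensions and sections of the process\<close>

locale fubini_process = L: prob_space L + P: prob_space P
  for L :: "'i measure" and P :: "'w measure" +
  fixes Q :: "('i \<times> 'w) measure" and f :: "'i \<times> 'w \<Rightarrow> 'x::polish_space"
  assumes complete_P: "complete_measure P"
    and extension: "fubini_extension L P Q"
    and f_measurable[measurable]: "f \<in> borel_measurable Q"
begin

sublocale Q: prob_space Q
  using extension unfolding fubini_extension_def by blast

lemma subalgebra_Q: "subalgebra Q (L \<Otimes>\<^sub>M P)"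
  using extension unfolding fubini_extension_def by blast

lemma space_Q: "space Q = space L \<times> space P"
  using subalgebra_Q by (simp add: subalgebra_def space_pair_measure)

lemma fubini:
  fixes h :: "'i \<times> 'w \<Rightarrow> real"
  assumes "integrable Q h"
  shows "AE i in L. integrable P (\<lambda>w. h (i, w))"
    and "AE w in P. integrable L (\<lambda>i. h (i, w))"
    and "integrable L (\<lambda>i. \<integral>w. h (i, w) \<partial>P)"
    and "integrable P (\<lambda>w. \<integral>i. h (i, w) \<partial>L)"
    and "(\<integral>x. h x \<partial>Q) = (\<integral>i. (\<integral>w. h (i, w) \<partial>P) \<partial>L)"
    and "(\<integral>x. h x \<partial>Q) = (\<integral>w. (\<integral>i. h (i, w) \<partial>L) \<partial>P)"
  using extension assms unfolding fubini_extension_def by blast+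

definition event :: "'x set \<Rightarrow> ('i \<times> 'w) set" where
  "event B = f -` B \<inter> space Q"

lemma event_sets: "B \<in> sets borel \<Longrightarrow> event B \<in> sets Q"
  unfolding event_def by (rule measurable_sets[OF f_measurable])

lemma integrable_event: "B \<in> sets borel \<Longrightarrow> integrable Q (indicator (event B) :: _ \<Rightarrow> real)"
  using event_sets by (simp add: Q.emeasure_eq_measure)

text \<open>The Fubini property makes the section of the indicator of \<open>event B\<close>
  integrable, hence measurable, outside a null set of agents depending on \<open>B\<close>. A
  countable Borel generator merges these null sets.\<close>

lemma AE_section_left_measurable: "AE i in L. (\<lambda>w. f (i, w)) \<in> borel_measurable P"
proof -
  obtain H :: "'x set set" where H: "countable H" "H \<subseteq> sets borel" "sets borel = sigma_sets UNIV H"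
    using borel_countable_Int_stable_generator by metis
  have "AE i in L. \<forall>B\<in>H. integrable P (\<lambda>w. indicator (event B) (i, w) :: real)"
    using H(1,2) fubini(1)[OF integrable_event] by (subst AE_ball_countable) auto
  then show ?thesis
    using AE_space
  proof eventually_elim
    case (elim i)
    show ?case
    proof (rule measurable_sigma_sets[OF H(3)])
      fix B assume "B \<in> H"
      with elim have "(\<lambda>w. indicator (event B) (i, w) :: real) \<in> borel_measurable P"
        by blast
      then have "indicat_real {w. (i, w) \<in> event B} \<in> borel_measurable P"
        by (simp add: indicator_def[abs_def])
      then have "{w. (i, w) \<in> event B} \<inter> space P \<in> sets P"
        by (simp only: borel_measurable_indicator_iff)
      also have "{w. (i, w) \<in> event B} \<inter> space P = (\<lambda>w. f (i, w)) -` B \<inter> space P"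
        using elim by (auto simp: event_def space_Q)
      finally show "(\<lambda>w. f (i, w)) -` B \<inter> space P \<in> sets P" .
    qed auto
  qed
qed

lemma AE_section_right_measurable: "AE w in P. (\<lambda>i. f (i, w)) \<in> borel_measurable L"
proof -
  obtain H :: "'x set set" where H: "countable H" "H \<subseteq> sets borel" "sets borel = sigma_sets UNIV H"
    using borel_countable_Int_stable_generator by metis
  have "AE w in P. \<forall>B\<in>H. integrable L (\<lambda>i. indicator (event B) (i, w) :: real)"
    using H(1,2) fubini(2)[OF integrable_event] by (subst AE_ball_countable) auto
  then show ?thesis
    using AE_space
  proof eventually_elim
    case (elim w)
    show ?case
    proof (rule measurable_sigma_sets[OF H(3)])
      fix B assume "B \<in> H"
      with elim have "(\<lambda>i. indicator (event B) (i, w) :: real) \<in> borel_measurable L"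
        by blast
      then have "indicat_real {i. (i, w) \<in> event B} \<in> borel_measurable L"
        by (simp add: indicator_def[abs_def])
      then have "{i. (i, w) \<in> event B} \<inter> space L \<in> sets L"
        by (simp only: borel_measurable_indicator_iff)
      also have "{i. (i, w) \<in> event B} \<inter> space L = (\<lambda>i. f (i, w)) -` B \<inter> space L"
        using elim by (auto simp: event_def space_Q)
      finally show "(\<lambda>i. f (i, w)) -` B \<inter> space L \<in> sets L" .
    qed auto
  qed
qed

section \<open>Integrals over rectangles and coalition shares\<close>

text \<open>\<open>Q\<close> agrees with the product measure on cylinders, so its second marginal is
  \<open>P\<close> and integrability of \<open>v\<close> carries over to \<open>Q\<close>; the
  indicator is a bounded factor.\<close>

lemma integrable_rectangle:
  fixes v :: "'w \<Rightarrow> real"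
  assumes A: "A \<in> sets L" and v: "integrable P v"
  shows "integrable Q (\<lambda>x. indicator A (fst x) * v (snd x))"
proof -
  have snd: "snd \<in> measurable Q P"
    using subalgebra_Q measurable_snd by (rule measurable_from_subalg)
  have "distr Q P snd = P"
  proof (rule measure_eqI)
    fix B assume "B \<in> sets (distr Q P snd)"
    then have B: "B \<in> sets P" by simp
    then have "snd -` B \<inter> space Q = space L \<times> B"
      using sets.sets_into_space by (auto simp: space_Q)
    then have "emeasure (distr Q P snd) B = emeasure Q (space L \<times> B)"
      using snd B by (simp add: emeasure_distr)
    also have "\<dots> = emeasure (L \<Otimes>\<^sub>M P) (space L \<times> B)"
      using extension B unfolding fubini_extension_def by auto
    also have "\<dots> = emeasure P B"
      using B by (simp add: P.emeasure_pair_measure_Times L.emeasure_space_1)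
    finally show "emeasure (distr Q P snd) B = emeasure P B" .
  qed simp
  then have "integrable (distr Q P snd) v"
    using v by simp
  then have "integrable Q (\<lambda>x. v (snd x))"
    using snd by (rule integrable_distr[rotated])
  moreover have "(\<lambda>x. indicator A (fst x) :: real) \<in> borel_measurable Q"
    using subalgebra_Q by (rule measurable_from_subalg) (use A in measurable)
  ultimately show ?thesis
    by (rule integrable_bounded_mult) (auto simp: indicator_def)
qed

lemma integrable_rectangle_mult:
  fixes v :: "'w \<Rightarrow> real"
  assumes "A \<in> sets L" and "integrable P v"
    and "h \<in> borel_measurable Q" and "AE x in Q. \<bar>h x\<bar> \<le> 1"
  shows "integrable Q (\<lambda>x. indicator A (fst x) * v (snd x) * h x)"
  using integrable_bounded_mult[OF integrable_rectangle[OF assms(1,2)] assms(3,4)]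
  by (simp add: mult.commute)

text \<open>The share is the inner integral over agents of the indicator of the event, so both parts
  are the Fubini property with the agents integrated out first. The weight \<open>v\<close> is a
  test function on the sample space.\<close>

lemma integral_coalition_share:
  assumes A: "A \<in> sets L" and B: "B \<in> sets borel" and v: "integrable P v"
  shows "integrable P (\<lambda>w. v w * coalition_share L f A B w)"
    and "(\<integral>x. indicator A (fst x) * v (snd x) * indicator (event B) x \<partial>Q) =
      (\<integral>w. v w * coalition_share L f A B w \<partial>P)"
proof -
  let ?k = "\<lambda>x. indicator A (fst x) * v (snd x) * indicator (event B) x"
  have int: "integrable Q ?k"
    using A v event_sets[OF B] by (intro integrable_rectangle_mult) auto
  \<comment> \<open>At a \<open>w\<close> whose set of agents is not measurable, both sides are 0 by
    the default values of the integral and of \<open>measure\<close>.\<close>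
  have inner: "(\<integral>i. ?k (i, w) \<partial>L) = v w * coalition_share L f A B w" if "w \<in> space P" for w
  proof -
    have "(\<integral>i. ?k (i, w) \<partial>L) = (\<integral>i. v w * indicator {i \<in> A. f (i, w) \<in> B} i \<partial>L)"
      using that by (intro Bochner_Integration.integral_cong) (auto simp: indicator_def event_def space_Q)
    also have "\<dots> = v w * measure L ({i \<in> A. f (i, w) \<in> B} \<inter> space L)"
      by simp
    also have "{i \<in> A. f (i, w) \<in> B} \<inter> space L = {i \<in> A. f (i, w) \<in> B}"
      using sets.sets_into_space[OF A] by auto
    finally show ?thesis
      by (simp add: coalition_share_def)
  qed
  show "integrable P (\<lambda>w. v w * coalition_share L f A B w)"
    using fubini(4)[OF int] inner by (simp cong: Bochner_Integration.integrable_cong)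
  show "(\<integral>x. ?k x \<partial>Q) = (\<integral>w. v w * coalition_share L f A B w \<partial>P)"
    unfolding fubini(6)[OF int] using inner by (rule Bochner_Integration.integral_cong[OF refl])
qed

lemma integrable_coalition_share:
  assumes "A \<in> sets L" and "B \<in> sets borel"
  shows "integrable P (coalition_share L f A B)"
  using integral_coalition_share(1)[OF assms, of "\<lambda>_. 1"] by simp

lemma subalgebra_Q_pair:
  assumes "subalgebra P C"
  shows "subalgebra Q (L \<Otimes>\<^sub>M C)"
proof -
  have "subalgebra (L \<Otimes>\<^sub>M P) (L \<Otimes>\<^sub>M C)"
    using assms by (intro subalgebra_pair_measure) (auto simp: subalgebra_def)
  then show ?thesis
    using subalgebra_Q unfolding subalgebra_def by auto
qed

lemma integral_rectangle_cond_exp: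
  fixes v :: "'w \<Rightarrow> real"
  assumes sub: "subalgebra P C" and h: "h \<in> borel_measurable (L \<Otimes>\<^sub>M C)"
    and eq: "AE x in Q. h x = real_cond_exp Q (L \<Otimes>\<^sub>M C) (indicator (event B)) x"
    and A: "A \<in> sets L" and B: "B \<in> sets borel" and v: "v \<in> borel_measurable C" "integrable P v"
  shows "integrable Q (\<lambda>x. indicator A (fst x) * v (snd x) * h x)"
    and "(\<integral>x. indicator A (fst x) * v (snd x) * h x \<partial>Q) = (\<integral>w. v w * coalition_share L f A B w \<partial>P)"
proof -
  note subQ = subalgebra_Q_pair[OF sub]
  interpret cond: finite_measure_subalgebra Q "L \<Otimes>\<^sub>M C"
    by unfold_locales (rule subQ)
  have hQ: "h \<in> borel_measurable Q"
    using subQ h by (rule measurable_from_subalg)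
  have bound: "AE x in Q. \<bar>h x\<bar> \<le> 1"
    using eq Q.cond_exp_indicator(1)[OF subQ event_sets[OF B]] by eventually_elim simp
  show int: "integrable Q (\<lambda>x. indicator A (fst x) * v (snd x) * h x)"
    using A v(2) hQ bound by (rule integrable_rectangle_mult)
  have rect: "(\<lambda>x. indicator A (fst x) * v (snd x)) \<in> borel_measurable (L \<Otimes>\<^sub>M C)"
    using A v(1) by measurable
  have int_event: "integrable Q (\<lambda>x. indicator A (fst x) * v (snd x) * indicator (event B) x)"
    using A v(2) event_sets[OF B] by (intro integrable_rectangle_mult) auto
  have "(\<integral>x. indicator A (fst x) * v (snd x) * h x \<partial>Q) =
      (\<integral>x. indicator A (fst x) * v (snd x) * real_cond_exp Q (L \<Otimes>\<^sub>M C) (indicator (event B)) x \<partial>Q)"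
  proof (rule integral_cong_AE)
    show "(\<lambda>x. indicator A (fst x) * v (snd x) * real_cond_exp Q (L \<Otimes>\<^sub>M C) (indicator (event B)) x) \<in> borel_measurable Q"
      using measurable_from_subalg[OF subQ rect] by (rule borel_measurable_times) (rule borel_measurable_cond_exp2)
  qed (use eq int in auto)
  also have "\<dots> = (\<integral>x. indicator A (fst x) * v (snd x) * indicator (event B) x \<partial>Q)"
    using int_event rect event_sets[OF B] by (intro cond.real_cond_exp_intg(2)) auto
  also have "\<dots> = (\<integral>w. v w * coalition_share L f A B w \<partial>P)"
    using A B v(2) by (rule integral_coalition_share(2))
  finally show "(\<integral>x. indicator A (fst x) * v (snd x) * h x \<partial>Q) = (\<integral>w. v w * coalition_share L f A B w \<partial>P)" .
qed

text \<open>Integrating over \<open>A \<times> D\<close> with \<open>D \<in> sets C\<close> in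
  either order gives the share and the integral of \<open>h\<close> over \<open>A\<close> the same
  integral over \<open>D\<close>. Both are \<open>C\<close>-measurable, so they agree almost
  everywhere.\<close>

lemma coalition_share_eq_integral:
  assumes sub: "subalgebra P C" and share: "coalition_share L f A B \<in> borel_measurable C"
    and h: "h \<in> borel_measurable (L \<Otimes>\<^sub>M C)"
    and eq: "AE x in Q. h x = real_cond_exp Q (L \<Otimes>\<^sub>M C) (indicator (event B)) x"
    and A: "A \<in> sets L" and B: "B \<in> sets borel"
  shows "integrable P (\<lambda>w. LINT i:A|L. h (i, w))"
    and "AE w in P. coalition_share L f A B w = (LINT i:A|L. h (i, w))"
proof -
  interpret finite_measure_subalgebra P C
    by unfold_locales (rule sub)
  note rect = integral_rectangle_cond_exp[OF sub h eq A B]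
  have C_P: "D \<in> sets P" if "D \<in> sets C" for D
    using sub that by (auto simp: subalgebra_def)
  have int: "integrable P (indicator D :: _ \<Rightarrow> real)" if "D \<in> sets C" for D
    using C_P[OF that] by (rule P.cond_exp_indicator(3)[OF sub])
  show h_int: "integrable P (\<lambda>w. LINT i:A|L. h (i, w))"
  proof -
    have "integrable Q (\<lambda>x. indicator A (fst x) * 1 * h x)"
      by (rule rect(1)) simp_all
    from fubini(4)[OF this] show ?thesis
      by (simp add: set_lebesgue_integral_def)
  qed
  have "AE w in P. real_cond_exp P C (coalition_share L f A B) w = (LINT i:A|L. h (i, w))"
  proof (rule real_cond_exp_charact)
    show "integrable P (coalition_share L f A B)"
      using A B by (rule integrable_coalition_share)
    show "integrable P (\<lambda>w. LINT i:A|L. h (i, w))" by fact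
    \<comment> \<open>Integrating out the agent leaves a \<open>C\<close>-measurable function; the
      coordinates are exchanged because the second one is integrated out.\<close>
    have "(\<lambda>(w, i). indicator A i *\<^sub>R h (i, w)) \<in> borel_measurable (C \<Otimes>\<^sub>M L)"
      using A h by measurable
    then show "(\<lambda>w. LINT i:A|L. h (i, w)) \<in> borel_measurable C"
      unfolding set_lebesgue_integral_def by (rule L.borel_measurable_lebesgue_integral)
    fix D assume D: "D \<in> sets C"
    then have "(LINT w:D|P. coalition_share L f A B w) =
        (\<integral>x. indicator A (fst x) * indicator D (snd x) * h x \<partial>Q)"
      using rect(2)[OF _ int[OF D]] by (simp add: set_lebesgue_integral_def)
    also have "\<dots> = (\<integral>w. (\<integral>i. indicator D w * (indicator A i * h (i, w)) \<partial>L) \<partial>P)"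
      using fubini(6)[OF rect(1)[OF _ int[OF D]]] D by (simp add: ac_simps)
    also have "\<dots> = (LINT w:D|P. (LINT i:A|L. h (i, w)))"
      by (simp add: set_lebesgue_integral_def)
    finally show "(LINT w:D|P. coalition_share L f A B w) = (LINT w:D|P. (LINT i:A|L. h (i, w)))" .
  qed
  moreover have "AE w in P. real_cond_exp P C (coalition_share L f A B) w = coalition_share L f A B w"
    using integrable_coalition_share[OF A B] share by (rule real_cond_exp_F_meas)
  ultimately show "AE w in P. coalition_share L f A B w = (LINT i:A|L. h (i, w))"
    by eventually_elim simp
qed

section \<open>Reduction to generating coalitions\<close>

text \<open>Pulls the generator back along \<open>f\<close>, so that integrals over events of
  \<open>f\<close> need be tested only for values in \<open>H\<close>.\<close>

lemma event_in_sigma_sets: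
  assumes H: "Int_stable H" "UNIV \<in> H" "H \<subseteq> sets borel" "sets borel = sigma_sets UNIV H"
  shows "Int_stable (event ` H)" and "space Q \<in> event ` H" and "event ` H \<subseteq> sets Q"
    and "B \<in> sets borel \<Longrightarrow> event B \<in> sigma_sets (space Q) (event ` H)"
proof -
  show "Int_stable (event ` H)"
  proof (rule Int_stableI)
    fix a b assume "a \<in> event ` H" "b \<in> event ` H"
    then obtain A B where "a = event A" "b = event B" "A \<in> H" "B \<in> H"
      by blast
    then have "a \<inter> b = event (A \<inter> B)" "A \<inter> B \<in> H"
      using H(1) by (auto simp: Int_stable_def event_def)
    then show "a \<inter> b \<in> event ` H" by blast
  qed
  have "event UNIV = space Q"
    by (simp add: event_def)
  then show "space Q \<in> event ` H"
    using H(2) by (metis imageI)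
  show "event ` H \<subseteq> sets Q"
    using H(3) event_sets by blast
  show "event B \<in> sigma_sets (space Q) (event ` H)" if "B \<in> sets borel"
  proof -
    have "event B \<in> {f -` B \<inter> space Q | B. B \<in> sigma_sets UNIV H}"
      using that H(4) unfolding event_def by blast
    also have "\<dots> = sigma_sets (space Q) {f -` B \<inter> space Q | B. B \<in> H}"
      by (rule sigma_sets_vimage_commute) simp
    also have "{f -` B \<inter> space Q | B. B \<in> H} = event ` H"
      unfolding event_def by blast
    finally show ?thesis .
  qed
qed

text \<open>
  For \<open>v = 1\<^sub>D - E(1\<^sub>D | F)\<close> and \<open>h\<close> the conditional expectation of the indicator of the event given the
  product \<open>\<sigma>\<close>-algebra, \<open>\<kappa> i = \<integral> v \<cdot> h(i,\<cdot>) dP\<close> is measurable for the \<open>\<sigma>\<close>-algebra generated by \<open>G\<close> and its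
  integrals over members of \<open>G\<close> vanish. So \<open>\<kappa> = 0\<close> almost everywhere, and no further coalition
  contributes anything new.
\<close>

lemma coalition_share_measurable_from_generators:
  assumes sub: "subalgebra P F" and null: "null_sets P \<subseteq> sets F"
    and H: "Int_stable H" "UNIV \<in> H" "H \<subseteq> sets borel" "sets borel = sigma_sets UNIV H"
    and G: "Int_stable G" "space L \<in> G" "G \<subseteq> sets L"
    and h: "\<And>B. B \<in> H \<Longrightarrow>
      real_cond_exp Q (L \<Otimes>\<^sub>M P) (indicator (event B)) \<in> borel_measurable (sigma (space L) G \<Otimes>\<^sub>M P)"
    and share: "\<And>A B. A \<in> G \<Longrightarrow> B \<in> H \<Longrightarrow> coalition_share L f A B \<in> borel_measurable F"
    and A: "A \<in> sets L" and B: "B \<in> sets borel"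
  shows "coalition_share L f A B \<in> borel_measurable F"
proof (rule measurable_if_cond_exp_pairing[OF P.prob_space_axioms complete_P sub null])
  interpret finite_measure_subalgebra P F
    by unfold_locales (rule sub)
  show "integrable P (coalition_share L f A B)"
    using A B by (rule integrable_coalition_share)
  fix D assume D: "D \<in> sets P"
  define d where "d = real_cond_exp P F (indicator D)"
  \<comment> \<open>\<open>v\<close> integrates to 0 against every integrable
    \<open>F\<close>-measurable function; the pairing criterion asks for the same against the
    share.\<close>
  define v where "v w = indicator D w - d w" for w
  have d: "AE w in P. \<bar>d w\<bar> \<le> 1" "integrable P d" and int_D: "integrable P (indicator D :: _ \<Rightarrow> real)"
    unfolding d_def using P.cond_exp_indicator[OF sub D] by auto
  have v: "integrable P v"
    unfolding v_def using int_D d(2) by (rule Bochner_Integration.integrable_diff)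
  have rect: "integrable Q (\<lambda>x. indicator A' (fst x) * v (snd x))" if "A' \<in> sets L" for A'
    using that v by (rule integrable_rectangle)
  have event_pairing: "(LINT x:event B'|Q. indicator A' (fst x) * v (snd x)) =
      (\<integral>w. v w * coalition_share L f A' B' w \<partial>P)" if "A' \<in> sets L" "B' \<in> sets borel" for A' B'
    using integral_coalition_share(2)[OF that v] by (simp add: set_lebesgue_integral_def ac_simps)
  have zero: "(LINT x:event B'|Q. indicator A' (fst x) * v (snd x)) = 0"
    if A': "A' \<in> sets L" and B': "B' \<in> H" for A' B'
  proof -
    have B'': "B' \<in> sets borel"
      using B' H(3) by blast
    let ?h = "real_cond_exp Q (L \<Otimes>\<^sub>M P) (indicator (event B'))"
    define \<kappa> where "\<kappa> i = (\<integral>w. v w * ?h (i, w) \<partial>P)" for i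
    \<comment> \<open>Conditioning on all of \<open>P\<close> admits the weight \<open>v\<close>,
      which is measurable for \<open>P\<close> but in general not for \<open>F\<close>.\<close>
    have subP: "subalgebra P P"
      by (simp add: subalgebra_def)
    have kappa: "integrable L (\<lambda>i. indicator S i * \<kappa> i)"
      "(LINT i:S|L. \<kappa> i) = (\<integral>w. v w * coalition_share L f S B' w \<partial>P)" if S: "S \<in> sets L" for S
    proof -
      have rect': "integrable Q (\<lambda>x. indicator S (fst x) * v (snd x) * ?h x)"
        "(\<integral>x. indicator S (fst x) * v (snd x) * ?h x \<partial>Q) = (\<integral>w. v w * coalition_share L f S B' w \<partial>P)"
        by (rule integral_rectangle_cond_exp[OF subP borel_measurable_cond_exp AE_I2[OF refl] S B''
          borel_measurable_integrable[OF v] v])+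
      show "integrable L (\<lambda>i. indicator S i * \<kappa> i)"
        using fubini(3)[OF rect'(1)] by (simp add: \<kappa>_def mult.assoc)
      show "(LINT i:S|L. \<kappa> i) = (\<integral>w. v w * coalition_share L f S B' w \<partial>P)"
        using fubini(5)[OF rect'(1)] rect'(2) by (simp add: \<kappa>_def mult.assoc set_lebesgue_integral_def)
    qed
    have int_kappa: "integrable L \<kappa>"
    proof -
      have "integrable L (\<lambda>i. indicator (space L) i * \<kappa> i)"
        by (rule kappa(1)) simp
      then show ?thesis
        by (simp cong: Bochner_Integration.integrable_cong)
    qed
    have on_G: "(LINT i:S|L. \<kappa> i) = 0" if S: "S \<in> G" for S
    proof -
      have SL: "S \<in> sets L"
        using S G(3) by blast
      let ?x = "coalition_share L f S B'"
      have x: "?x \<in> borel_measurable F" "integrable P ?x"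
        using share[OF S B'] integrable_coalition_share[OF SL B''] by auto
      have int1: "integrable P (\<lambda>w. ?x w * indicator D w)"
        using integrable_mult_indicator[OF D x(2)] by (simp add: mult.commute)
      have "(\<integral>w. ?x w * d w \<partial>P) = (\<integral>w. ?x w * indicator D w \<partial>P)"
        unfolding d_def using int1 x(1) D by (intro real_cond_exp_intg(2)) auto
      moreover have "integrable P (\<lambda>w. ?x w * d w)"
        using integrable_bounded_mult[OF x(2) borel_measurable_integrable[OF d(2)] d(1)] by (simp add: mult.commute)
      ultimately have "(\<integral>w. v w * ?x w \<partial>P) = 0"
        using int1 by (simp add: v_def right_diff_distrib mult.commute[of _ "?x _"])
      then show ?thesis
        using kappa(2)[OF SL] by simp
    qed
    let ?S = "sigma (space L) G"
    have G_Pow: "G \<subseteq> Pow (space L)"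
      using G(3) sets.sets_into_space by blast
    then have sets_S: "sets ?S = sigma_sets (space L) G"
      by (rule sets_measure_of)
    have subS: "subalgebra L ?S"
      using sets.sigma_sets_subset[OF G(3)] sets_S by (simp add: subalgebra_def space_measure_of_conv)
    \<comment> \<open>\<open>?h\<close> is measurable for the product of \<open>?S\<close> and
      \<open>P\<close>, and integrating out the sample point leaves a \<open>?S\<close>-measurable
      function.\<close>
    have kappa_S: "\<kappa> \<in> borel_measurable ?S"
    proof -
      have "(\<lambda>(i, w). v w * ?h (i, w)) \<in> borel_measurable (?S \<Otimes>\<^sub>M P)"
        using h[OF B'] borel_measurable_integrable[OF v] by measurable
      then show ?thesis
        unfolding \<kappa>_def by (rule P.borel_measurable_lebesgue_integral)
    qed
    \<comment> \<open>Uniqueness of densities is applied on the restriction to \<open>?S\<close>: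
      since \<open>\<kappa>\<close> is \<open>?S\<close>-measurable, its integrals over sets of
      \<open>?S\<close> alone decide that it vanishes almost everywhere. Then its integral over any
      \<open>A'\<close> vanishes.\<close>
    have "AE i in restr_to_subalg L ?S. \<kappa> i = 0"
    proof (rule density_unique_real)
      show "integrable (restr_to_subalg L ?S) \<kappa>"
        using subS kappa_S int_kappa by (rule integrable_in_subalg)
      fix S assume "S \<in> sets (restr_to_subalg L ?S)"
      then have S: "S \<in> sets ?S"
        using sets_restr_to_subalg[OF subS] by blast
      then have S': "S \<in> sigma_sets (space L) (G \<union> null_sets L)"
        using sets_S sigma_sets_mono'[of G "G \<union> null_sets L" "space L"] by blast
      have "(\<lambda>i. indicator S i *\<^sub>R \<kappa> i) \<in> borel_measurable ?S"
        using S kappa_S by (intro borel_measurable_scaleR borel_measurable_indicator)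
      then have "(LINT i:S|restr_to_subalg L ?S. \<kappa> i) = (LINT i:S|L. \<kappa> i)"
        unfolding set_lebesgue_integral_def by (rule integral_subalgebra2[OF subS])
      also have "\<dots> = 0"
        using int_kappa G(1) G(3) G(2) on_G S' by (rule set_integral_eq_0_sigma_sets)
      finally show "(LINT i:S|restr_to_subalg L ?S. \<kappa> i) = (LINT i:S|restr_to_subalg L ?S. 0)"
        by (simp add: set_lebesgue_integral_def)
    qed simp
    then have "AE i in L. \<kappa> i = 0"
      by (rule AE_restr_to_subalg[OF subS])
    then have "(LINT i:A'|L. \<kappa> i) = 0"
      unfolding set_lebesgue_integral_def by (intro integral_eq_zero_AE) auto
    then show ?thesis
      using kappa(2)[OF A'] event_pairing[OF A' B''] by simp
  qed
  \<comment> \<open>With the coalition \<open>A\<close> fixed, the Dynkin argument on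
    \<open>Q\<close> passes from members of \<open>H\<close> to an arbitrary Borel set
    \<open>B\<close>.\<close>
  have "(LINT x:event B|Q. indicator A (fst x) * v (snd x)) = 0"
  proof (rule set_integral_eq_0_sigma_sets[OF rect[OF A]])
    show "event B \<in> sigma_sets (space Q) (event ` H \<union> null_sets Q)"
      using event_in_sigma_sets(4)[OF H B] sigma_sets_mono'[of "event ` H" "event ` H \<union> null_sets Q" "space Q"]
      by blast
    show "(LINT x:E|Q. indicator A (fst x) * v (snd x)) = 0" if "E \<in> event ` H" for E
      using that zero[OF A] by blast
  qed (fact event_in_sigma_sets[OF H])+
  then show "(\<integral>w. (indicator D w - real_cond_exp P F (indicator D) w) * coalition_share L f A B w \<partial>P) = 0"
    using event_pairing[OF A B] by (simp add: v_def d_def)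
qed

section \<open>Countable generation of the aggregate algebra\<close>

definition share_events :: "'w set set" where
  "share_events = {coalition_share L f A B -` D \<inter> space P | A B D.
    A \<in> sets L \<and> B \<in> sets borel \<and> D \<in> sets borel}"

lemma aggregate_algebra_eq: "aggregate_algebra L P f = generated_with_null_sets P share_events"
  unfolding aggregate_algebra_def share_events_def ..

lemma share_events_sets: "share_events \<subseteq> sets P"
  unfolding share_events_def
  using measurable_sets[OF borel_measurable_integrable[OF integrable_coalition_share]] by blast

lemma subalgebra_aggregate: "subalgebra P (aggregate_algebra L P f)"
  unfolding aggregate_algebra_eq using share_events_sets by (rule subalgebra_generated_with_null_sets)

lemma coalition_share_aggregate:
  assumes "A \<in> sets L" and "B \<in> sets borel"
  shows "coalition_share L f A B \<in> borel_measurable (aggregate_algebra L P f)"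
proof (rule measurableI)
  fix D :: "real set" assume "D \<in> sets borel"
  with assms have "coalition_share L f A B -` D \<inter> space P \<in> share_events"
    unfolding share_events_def by blast
  moreover have "space (aggregate_algebra L P f) = space P"
    using subalgebra_aggregate by (simp add: subalgebra_def)
  ultimately show "coalition_share L f A B -` D \<inter> space (aggregate_algebra L P f) \<in> sets (aggregate_algebra L P f)"
    by (simp add: aggregate_algebra_eq sets_generated_with_null_sets[OF share_events_sets])
qed simp

text \<open>Three countable generators are combined: \<open>H\<close> for the values of
  \<open>f\<close>, \<open>R\<close> for the values of the shares, and \<open>K\<close> for the
  coalitions entering the conditional expectations given \<open>L \<Otimes>\<^sub>M P\<close>. The
  shares indexed by \<open>K\<close> and \<open>H\<close> make all other shares measurable, so their
  events generate the same algebra.\<close>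

lemma countably_generated_aggregate: "countably_generated P (aggregate_algebra L P f)"
proof -
  let ?h = "\<lambda>B. real_cond_exp Q (L \<Otimes>\<^sub>M P) (indicator (event B))"
  obtain H :: "'x set set" where H: "countable H" "Int_stable H" "UNIV \<in> H" "H \<subseteq> sets borel"
      "sets borel = sigma_sets UNIV H"
    by (rule borel_countable_Int_stable_generator)
  obtain R :: "real set set" where R: "countable R" "Int_stable R" "UNIV \<in> R" "R \<subseteq> sets borel"
      "sets borel = sigma_sets UNIV R"
    by (rule borel_countable_Int_stable_generator)
  have "\<forall>B. \<exists>G. countable G \<and> G \<subseteq> sets L \<and> ?h B \<in> borel_measurable (sigma (space L) G \<Otimes>\<^sub>M P)"
  proof
    fix B
    obtain G where "countable G" "G \<subseteq> sets L" "?h B \<in> borel_measurable (sigma (space L) G \<Otimes>\<^sub>M P)"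
      by (rule borel_measurable_pair_countable_left[OF borel_measurable_cond_exp])
    then show "\<exists>G. countable G \<and> G \<subseteq> sets L \<and> ?h B \<in> borel_measurable (sigma (space L) G \<Otimes>\<^sub>M P)"
      by blast
  qed
  then obtain G where G: "\<forall>B. countable (G B) \<and> G B \<subseteq> sets L \<and>
      ?h B \<in> borel_measurable (sigma (space L) (G B) \<Otimes>\<^sub>M P)"
    by (rule choice[THEN exE])
  \<comment> \<open>Only the \<open>B \<in> H\<close> contribute, which keeps the family of
    coalitions countable.\<close>
  have "countable (\<Union>B\<in>H. G B)" "(\<Union>B\<in>H. G B) \<subseteq> sets L"
    using G H(1) by auto
  then obtain K where K: "countable K" "(\<Union>B\<in>H. G B) \<subseteq> K" "K \<subseteq> sets L" "Int_stable K" "space L \<in> K"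
    by (rule countable_Int_stable_superset)
  have h: "?h B \<in> borel_measurable (sigma (space L) K \<Otimes>\<^sub>M P)" if "B \<in> H" for B
  proof -
    have "G B \<subseteq> K" "K \<subseteq> Pow (space L)"
      using that K(2,3) sets.sets_into_space by blast+
    then have "sets (sigma (space L) (G B) \<Otimes>\<^sub>M P) \<subseteq> sets (sigma (space L) K \<Otimes>\<^sub>M P)"
      by (rule sets_pair_sigma_mono)
    then have "subalgebra (sigma (space L) K \<Otimes>\<^sub>M P) (sigma (space L) (G B) \<Otimes>\<^sub>M P)"
      by (simp add: subalgebra_def space_pair_measure space_measure_of_conv)
    then show ?thesis
      using G by (blast intro: measurable_from_subalg)
  qed
  let ?E = "(\<lambda>(A, B, D). coalition_share L f A B -` D \<inter> space P) ` (K \<times> H \<times> R)"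
  let ?F = "generated_with_null_sets P ?E"
  have E_share: "?E \<subseteq> share_events"
  proof clarify
    fix A B D assume "A \<in> K" "B \<in> H" "D \<in> R"
    then have "A \<in> sets L" "B \<in> sets borel" "D \<in> sets borel"
      using K(3) H(4) R(4) by blast+
    then show "coalition_share L f A B -` D \<inter> space P \<in> share_events"
      unfolding share_events_def by blast
  qed
  with share_events_sets have E: "?E \<subseteq> sets P"
    by (rule order_trans[rotated])
  note subF = subalgebra_generated_with_null_sets[OF E] and sets_F = sets_generated_with_null_sets[OF E]
  have null_F: "null_sets P \<subseteq> sets ?F"
    unfolding sets_F by blast
  have share_F: "coalition_share L f A B \<in> borel_measurable ?F" if "A \<in> K" "B \<in> H" for A B
  proof (rule measurable_sigma_sets[OF R(5)])
    fix D assume "D \<in> R"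
    with that have "coalition_share L f A B -` D \<inter> space P \<in> ?E"
      by (intro image_eqI[of _ _ "(A, B, D)"]) auto
    then show "coalition_share L f A B -` D \<inter> space ?F \<in> sets ?F"
      using subF unfolding sets_F by (auto simp: subalgebra_def)
  qed auto
  have "coalition_share L f A B \<in> borel_measurable ?F" if "A \<in> sets L" "B \<in> sets borel" for A B
    by (rule coalition_share_measurable_from_generators[OF subF null_F H(2-5) K(4,5,3) h share_F that])
  then have "coalition_share L f A B -` D \<inter> space P \<in> sets ?F"
    if "A \<in> sets L" "B \<in> sets borel" "D \<in> sets borel" for A B D
    using measurable_sets[OF _ that(3)] that(1,2) subF unfolding subalgebra_def by metis
  then have "share_events \<subseteq> sets ?F"
    unfolding share_events_def by blast
  with null_F have "share_events \<union> null_sets P \<subseteq> sets ?F"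
    by blast
  then have "sigma_sets (space ?F) (share_events \<union> null_sets P) \<subseteq> sets ?F"
    by (rule sets.sigma_sets_subset)
  then have "sets (aggregate_algebra L P f) \<subseteq> sets ?F"
    using subF by (simp add: aggregate_algebra_eq sets_generated_with_null_sets[OF share_events_sets] subalgebra_def)
  moreover have "sets ?F \<subseteq> sets (aggregate_algebra L P f)"
    unfolding aggregate_algebra_eq sets_F sets_generated_with_null_sets[OF share_events_sets]
    using E_share by (intro sigma_sets_mono') blast
  ultimately have "sets (aggregate_algebra L P f) = sets ?F"
    by blast
  moreover have "countable ?E"
    using K(1) H(1) R(1) by auto
  ultimately show ?thesis
    unfolding countably_generated_def using subalgebra_aggregate E by blast
qed

section \<open>No coalitional individual uncertainty in aggregation\<close>

text \<open>Each Borel set gives an equality outside its own null set. These null sets are merged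
  over the countable \<open>H\<close>; at a fixed sample point both sides are finite measures in
  \<open>B\<close>, so agreement on \<open>H\<close> extends to all Borel sets.\<close>

lemma no_coalitional_individual_uncertainty_aggregate:
  "no_coalitional_individual_uncertainty L P Q f (aggregate_algebra L P f)"
  unfolding no_coalitional_individual_uncertainty_def
proof (intro allI impI ballI)
  fix \<mu> A
  let ?C = "aggregate_algebra L P f"
  assume "regular_cond_distribution Q (L \<Otimes>\<^sub>M ?C) f \<mu>" and A: "A \<in> sets L"
  then have \<mu>: "\<mu> \<in> L \<Otimes>\<^sub>M ?C \<rightarrow>\<^sub>M prob_algebra borel"
    and eq: "\<And>B. B \<in> sets borel \<Longrightarrow> AE x in Q. measure (\<mu> x) B = real_cond_exp Q (L \<Otimes>\<^sub>M ?C) (indicator (event B)) x"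
    unfolding regular_cond_distribution_def cond_probability_def event_def by auto
  obtain H :: "'x set set" where H: "countable H" "Int_stable H" "UNIV \<in> H" "H \<subseteq> sets borel"
      "sets borel = sigma_sets UNIV H"
    by (rule borel_countable_Int_stable_generator)
  have "AE w in P. coalition_share L f A B w = (LINT i:A|L. measure (\<mu> (i, w)) B)" if "B \<in> H" for B
  proof -
    have B: "B \<in> sets borel"
      using that H(4) by blast
    have "(\<lambda>x. measure (\<mu> x) B) \<in> borel_measurable (L \<Otimes>\<^sub>M ?C)"
      using \<mu> B by measurable
    then show ?thesis
      using coalition_share_eq_integral(2)[OF subalgebra_aggregate coalition_share_aggregate[OF A B] _ eq[OF B] A B]
      by simp
  qed
  then have "AE w in P. \<forall>B\<in>H. coalition_share L f A B w = (LINT i:A|L. measure (\<mu> (i, w)) B)"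
    using H(1) by (subst AE_ball_countable) auto
  then show "AE w in P. \<forall>B\<in>sets borel. coalition_share L f A B w = (LINT i:A|L. measure (\<mu> (i, w)) B)"
    using AE_section_right_measurable AE_space
  proof eventually_elim
    case (elim w)
    \<comment> \<open>\<open>?LA\<close> is \<open>L\<close> concentrated on the coalition
      \<open>A\<close>. \<open>?N\<close> is the distribution of the section of \<open>f\<close>
      under it, and \<open>?K\<close> the mixture of the measures \<open>\<mu> (i, w)\<close> over
      it; their values are the two sides of the claim.\<close>
    let ?LA = "density L (indicator A)"
    let ?N = "distr ?LA borel (\<lambda>i. f (i, w))"
    let ?K = "?LA \<bind> (\<lambda>i. \<mu> (i, w))"
    have f_sec: "(\<lambda>i. f (i, w)) \<in> ?LA \<rightarrow>\<^sub>M borel"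
      using elim(2) by simp
    have "w \<in> space ?C"
      using elim(3) subalgebra_aggregate by (simp add: subalgebra_def)
    then have "(\<lambda>i. \<mu> (i, w)) \<in> L \<rightarrow>\<^sub>M prob_algebra borel"
      using measurable_compose[OF measurable_Pair2' \<mu>] by simp
    then have \<mu>_sec: "(\<lambda>i. \<mu> (i, w)) \<in> L \<rightarrow>\<^sub>M subprob_algebra borel"
      by (rule measurable_prob_algebraD)
    then have \<mu>_sec': "(\<lambda>i. \<mu> (i, w)) \<in> ?LA \<rightarrow>\<^sub>M subprob_algebra borel"
      by simp
    have N: "emeasure ?N B = ennreal (coalition_share L f A B w)" if B: "B \<in> sets borel" for B
    proof -
      have pre: "(\<lambda>i. f (i, w)) -` B \<inter> space L \<in> sets L"
        using elim(2) B by (rule measurable_sets)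
      have "emeasure ?N B = emeasure ?LA ((\<lambda>i. f (i, w)) -` B \<inter> space L)"
        using emeasure_distr[OF f_sec B] by simp
      also have "\<dots> = emeasure L (A \<inter> ((\<lambda>i. f (i, w)) -` B \<inter> space L))"
        using pre A by (simp add: emeasure_density indicator_inter_arith[symmetric])
      also have "A \<inter> ((\<lambda>i. f (i, w)) -` B \<inter> space L) = {i \<in> A. f (i, w) \<in> B}"
        using sets.sets_into_space[OF A] by auto
      finally show ?thesis
        by (simp add: coalition_share_def L.emeasure_eq_measure)
    qed
    have K: "emeasure ?K B = ennreal (LINT i:A|L. measure (\<mu> (i, w)) B)" if B: "B \<in> sets borel" for B
    proof -
      have meas: "(\<lambda>i. measure (\<mu> (i, w)) B) \<in> borel_measurable L"
        using \<mu>_sec B by measurable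
      have sub: "subprob_space (\<mu> (i, w))" if "i \<in> space L" for i
        using measurable_space[OF \<mu>_sec that] by (simp add: space_subprob_algebra)
      have int: "integrable L (\<lambda>i. indicator A i * measure (\<mu> (i, w)) B)"
      proof (rule L.integrable_const_bound[of _ 1])
        show "AE i in L. norm (indicator A i * measure (\<mu> (i, w)) B) \<le> 1"
          using AE_space
          by eventually_elim (auto simp: indicator_def intro: subprob_space.subprob_measure_le_1 sub)
        show "(\<lambda>i. indicator A i * measure (\<mu> (i, w)) B) \<in> borel_measurable L"
          using A meas by measurable
      qed
      have "emeasure ?K B = (\<integral>\<^sup>+i. emeasure (\<mu> (i, w)) B \<partial>?LA)"
        using L.not_empty \<mu>_sec' B by (intro emeasure_bind) auto
      also have "\<dots> = (\<integral>\<^sup>+i. indicator A i * emeasure (\<mu> (i, w)) B \<partial>L)"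
        using A measurable_emeasure_kernel[OF \<mu>_sec B] by (intro nn_integral_density) auto
      also have "\<dots> = (\<integral>\<^sup>+i. ennreal (indicator A i * measure (\<mu> (i, w)) B) \<partial>L)"
      proof (rule nn_integral_cong)
        fix i assume "i \<in> space L"
        then interpret subprob_space "\<mu> (i, w)" by (rule sub)
        show "indicator A i * emeasure (\<mu> (i, w)) B = ennreal (indicator A i * measure (\<mu> (i, w)) B)"
          by (simp add: emeasure_eq_measure indicator_def)
      qed
      also have "\<dots> = ennreal (LINT i:A|L. measure (\<mu> (i, w)) B)"
        using nn_integral_eq_integral[OF int] by (simp add: set_lebesgue_integral_def)
      finally show ?thesis .
    qed
    have "?N = ?K"
    proof (rule measure_eqI_generator_eq[OF H(2)])
      show "H \<subseteq> Pow UNIV" by simp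
      show "sets ?N = sigma_sets UNIV H"
        using H(5) by simp
      have "sets ?K = sets borel"
        using L.not_empty measurable_space[OF \<mu>_sec'] by (intro sets_bind) (auto simp: space_subprob_algebra)
      then show "sets ?K = sigma_sets UNIV H"
        using H(5) by simp
      show "emeasure ?N B = emeasure ?K B" if "B \<in> H" for B
        using that N K elim(1) H(4) by (metis subsetD)
      show "range (\<lambda>_. UNIV) \<subseteq> H" "(\<Union>i::nat. UNIV) = UNIV"
        using H(3) by auto
      show "emeasure ?N UNIV \<noteq> \<infinity>"
        using N[of UNIV] by simp
    qed
    show ?case
    proof
      fix B :: "'x set" assume B: "B \<in> sets borel"
      \<comment> \<open>Nonnegativity turns the equality in \<open>ennreal\<close> into one of
        reals.\<close>
      have "0 \<le> coalition_share L f A B w" "0 \<le> (LINT i:A|L. measure (\<mu> (i, w)) B)"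
        by (auto simp: coalition_share_def set_lebesgue_integral_def intro!: Bochner_Integration.integral_nonneg)
      then show "coalition_share L f A B w = (LINT i:A|L. measure (\<mu> (i, w)) B)"
        using \<open>?N = ?K\<close> N[OF B] K[OF B] by simp
    qed
  qed
qed

section \<open>Essential pairwise conditional independence\<close>

text \<open>
  Given \<open>C\<close>, almost every agent is independent of any fixed event \<open>E\<close>, because the distribution of
  \<open>f\<close> over every coalition is determined by \<open>C\<close> alone.
\<close>

lemma AE_event_section_eq:
  assumes sub: "subalgebra P C" and share: "\<And>A. A \<in> sets L \<Longrightarrow> coalition_share L f A B \<in> borel_measurable C"
    and B: "B \<in> sets borel" and E: "E \<in> sets P"
  shows "AE i in L. (LINT w:E|P. indicator (event B) (i, w) -
    real_cond_exp Q (L \<Otimes>\<^sub>M C) (indicator (event B)) (i, w)) = 0"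
proof -
  let ?h = "real_cond_exp Q (L \<Otimes>\<^sub>M C) (indicator (event B))"
  let ?k = "\<lambda>x. indicator (event B) x - ?h x"
  note subQ = subalgebra_Q_pair[OF sub]
  note h = Q.cond_exp_indicator[OF subQ event_sets[OF B]]
  have int_E: "integrable P (indicator E :: _ \<Rightarrow> real)"
    using E by (rule P.cond_exp_indicator(3)[OF sub])
  \<comment> \<open>\<open>E\<close> ranges over all of \<open>P\<close>: the identity between the
    share and the integral of \<open>?h\<close> holds almost everywhere, so it can be integrated
    over any event, including one outside \<open>C\<close>.\<close>
  have zero: "integrable Q (\<lambda>x. indicator A (fst x) * indicator E (snd x) * ?k x)"
    "(\<integral>x. indicator A (fst x) * indicator E (snd x) * ?k x \<partial>Q) = 0" if A: "A \<in> sets L" for A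
  proof -
    have i1: "integrable Q (\<lambda>x. indicator A (fst x) * indicator E (snd x) * indicator (event B) x :: real)"
      using A int_E event_sets[OF B] by (intro integrable_rectangle_mult) auto
    have i2: "integrable Q (\<lambda>x. indicator A (fst x) * indicator E (snd x) * ?h x)"
      using A int_E borel_measurable_integrable[OF h(2)] h(1) by (rule integrable_rectangle_mult)
    show "integrable Q (\<lambda>x. indicator A (fst x) * indicator E (snd x) * ?k x)"
      using Bochner_Integration.integrable_diff[OF i1 i2] by (simp add: right_diff_distrib)
    have "(\<integral>x. indicator A (fst x) * indicator E (snd x) * ?h x \<partial>Q) =
        (\<integral>w. (\<integral>i. indicator E w * (indicator A i * ?h (i, w)) \<partial>L) \<partial>P)"
      using fubini(6)[OF i2] by (simp add: ac_simps)
    also have "\<dots> = (\<integral>w. indicator E w * (LINT i:A|L. ?h (i, w)) \<partial>P)"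
      by (simp add: set_lebesgue_integral_def)
    also have "\<dots> = (\<integral>w. indicator E w * coalition_share L f A B w \<partial>P)"
    proof (rule integral_cong_AE)
      note eq = coalition_share_eq_integral[OF sub share[OF A] borel_measurable_cond_exp AE_I2[OF refl] A B]
      show "AE w in P. indicator E w * (LINT i:A|L. ?h (i, w)) = indicator E w * coalition_share L f A B w"
        using eq(2) by eventually_elim simp
      show "(\<lambda>w. indicator E w * (LINT i:A|L. ?h (i, w))) \<in> borel_measurable P"
        using E borel_measurable_integrable[OF eq(1)] by (intro borel_measurable_times borel_measurable_indicator)
      show "(\<lambda>w. indicator E w * coalition_share L f A B w) \<in> borel_measurable P"
        using E borel_measurable_integrable[OF integrable_coalition_share[OF A B]]
        by (intro borel_measurable_times borel_measurable_indicator)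
    qed
    also have "\<dots> = (\<integral>x. indicator A (fst x) * indicator E (snd x) * indicator (event B) x \<partial>Q)"
      using integral_coalition_share(2)[OF A B int_E] by simp
    finally show "(\<integral>x. indicator A (fst x) * indicator E (snd x) * ?k x \<partial>Q) = 0"
      using Bochner_Integration.integral_diff[OF i1 i2] by (simp add: right_diff_distrib)
  qed
  have sec: "integrable L (\<lambda>i. indicator A i * (LINT w:E|P. ?k (i, w)))"
    "(LINT i:A|L. (LINT w:E|P. ?k (i, w))) = 0" if "A \<in> sets L" for A
    using fubini(3,5)[OF zero(1)[OF that]] zero(2)[OF that]
    by (simp_all add: set_lebesgue_integral_def mult.assoc)
  show ?thesis
  proof (rule density_unique_real)
    have "integrable L (\<lambda>i. indicator (space L) i * (LINT w:E|P. ?k (i, w)))"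
      by (rule sec(1)) simp
    then show "integrable L (\<lambda>i. LINT w:E|P. ?k (i, w))"
      by (simp cong: Bochner_Integration.integrable_cong)
    show "(LINT i:A|L. (LINT w:E|P. ?k (i, w))) = (LINT i:A|L. 0)" if "A \<in> sets L" for A
      using sec(2)[OF that] by (simp add: set_lebesgue_integral_def)
  qed simp
qed

text \<open>The exceptional agents \<open>i2\<close> may depend on \<open>i1\<close> but not on the
  events tested. For fixed \<open>i1\<close>, countable generation of \<open>C\<close> and of the
  Borel sets yields a countable intersection-stable family which, with the null sets, generates a
  sigma-algebra containing \<open>C\<close> and the events of \<open>f\<close> at \<open>i1\<close>.
  One null set of agents \<open>i2\<close> serves for all its members.\<close>

lemma essentially_pairwise_cond_independent_aggregate:
  "essentially_pairwise_cond_independent L P (aggregate_algebra L P f) f"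
proof -
  define C where "C = aggregate_algebra L P f"
  let ?h = "\<lambda>B. real_cond_exp Q (L \<Otimes>\<^sub>M C) (indicator (event B))"
  have sub: "subalgebra P C"
    unfolding C_def by (rule subalgebra_aggregate)
  obtain G where G: "countable G" "G \<subseteq> sets P" "sets C = sigma_sets (space P) (G \<union> null_sets P)"
    using countably_generated_aggregate sets_generated_with_null_sets
    unfolding countably_generated_def C_def by metis
  obtain H :: "'x set set" where H: "countable H" "Int_stable H" "UNIV \<in> H" "H \<subseteq> sets borel"
      "sets borel = sigma_sets UNIV H"
    by (rule borel_countable_Int_stable_generator)
  have "AE i1 in L. AE i2 in L. cond_independent P C (\<lambda>w. f (i1, w)) (\<lambda>w. f (i2, w))"
    using AE_section_left_measurable
  proof eventually_elim
    case (elim i1)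
    let ?\<phi> = "\<lambda>w. f (i1, w)"
    let ?G = "(\<lambda>B. ?\<phi> -` B \<inter> space P) ` H"
    have "countable (G \<union> ?G)"
      using G(1) H(1) by auto
    moreover have "G \<union> ?G \<subseteq> sets P"
      using G(2) measurable_sets[OF elim] H(4) by blast
    ultimately obtain K where K: "countable K" "G \<union> ?G \<subseteq> K" "K \<subseteq> sets P" "Int_stable K" "space P \<in> K"
      by (rule countable_Int_stable_superset)
    \<comment> \<open>\<open>S\<close> contains \<open>C\<close> and the events of
      \<open>?\<phi>\<close>, hence also the intersections tested in
      \<open>cond_independentI\<close>.\<close>
    define S where "S = sigma_sets (space P) (K \<union> null_sets P)"
    have C_S: "sets C \<subseteq> S"
      unfolding G(3) S_def using K(2) by (intro sigma_sets_mono') blast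
    have \<phi>_S: "?\<phi> -` B \<inter> space P \<in> S" if "B \<in> sets borel" for B
    proof -
      have "?\<phi> -` B \<inter> space P \<in> {?\<phi> -` B \<inter> space P | B. B \<in> sigma_sets UNIV H}"
        using that H(5) by blast
      also have "\<dots> = sigma_sets (space P) {?\<phi> -` B \<inter> space P | B. B \<in> H}"
        by (rule sigma_sets_vimage_commute) simp
      also have "\<dots> \<subseteq> S"
        unfolding S_def using K(2) by (intro sigma_sets_mono') blast
      finally show ?thesis .
    qed
    have "K \<union> null_sets P \<subseteq> sets P"
      using K(3) by auto
    then have "K \<union> null_sets P \<subseteq> Pow (space P)"
      using sets.sets_into_space by blast
    then have "sets (sigma (space P) (K \<union> null_sets P)) = S"
      unfolding S_def by (rule sets_measure_of)
    then have Int_S: "a \<inter> b \<in> S" if "a \<in> S" "b \<in> S" for a b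
      using that sets.Int by metis
    \<comment> \<open>\<open>AE_event_section_eq\<close> is applied to events \<open>E\<close> that
      may involve \<open>f\<close> at \<open>i1\<close> as well as \<open>C\<close>; the countably
      many pairs of \<open>B\<close> and \<open>E\<close> leave a common null set.\<close>
    have "AE i2 in L. \<forall>B\<in>H. \<forall>E\<in>K. (LINT w:E|P. indicator (event B) (i2, w) - ?h B (i2, w)) = 0"
    proof -
      have "AE i2 in L. (LINT w:E|P. indicator (event B) (i2, w) - ?h B (i2, w)) = 0"
        if "B \<in> H" "E \<in> K" for B E
        using that H(4) K(3) coalition_share_aggregate
        by (intro AE_event_section_eq sub) (auto simp: C_def)
      then show ?thesis
        using H(1) K(1) by (simp add: AE_ball_countable)
    qed
    moreover have "AE i2 in L. \<forall>B\<in>H. integrable P (\<lambda>w. ?h B (i2, w))"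
    proof -
      have "AE i2 in L. integrable P (\<lambda>w. ?h B (i2, w))" if "B \<in> H" for B
        using that H(4) Q.cond_exp_indicator(2)[OF subalgebra_Q_pair[OF sub] event_sets]
        by (intro fubini(1)) blast
      then show ?thesis
        using H(1) by (simp add: AE_ball_countable)
    qed
    ultimately show "AE i2 in L. cond_independent P C ?\<phi> (\<lambda>w. f (i2, w))"
      using AE_section_left_measurable AE_space
    proof eventually_elim
      case (elim i2)
      let ?\<psi> = "\<lambda>w. f (i2, w)"
      \<comment> \<open>The section at \<open>i2\<close> of the conditional expectation given
        \<open>L \<Otimes>\<^sub>M C\<close> is the \<open>C\<close>-measurable candidate for the
        conditional probability of events of \<open>?\<psi>\<close>.\<close>
      show ?case
      proof (rule cond_independentI[where u = "\<lambda>B w. ?h B (i2, w)", OF P.prob_space_axioms sub _ elim(3) H(2-5)])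
        show "?\<phi> \<in> borel_measurable P" by fact
        show "(\<lambda>w. ?h B (i2, w)) \<in> borel_measurable C" for B
          using measurable_compose[OF measurable_Pair1'[OF elim(4)] borel_measurable_cond_exp] .
        show "integrable P (\<lambda>w. ?h B (i2, w))" if "B \<in> H" for B
          using elim(2) that by blast
        fix D and B1 B2 :: "'x set"
        assume D: "D \<in> sets C" and B1: "B1 \<in> sets borel" and B2: "B2 \<in> H"
        let ?X = "D \<inter> (?\<phi> -` B1 \<inter> space P)" and ?Y = "?\<psi> -` B2 \<inter> space P"
        have Y: "?Y \<in> sets P"
          using elim(3) B2 H(4) by (intro measurable_sets) auto
        have X: "?X \<in> S"
          using C_S D \<phi>_S[OF B1] Int_S by blast
        have "S \<subseteq> sets P"
          unfolding S_def by (rule sets.sigma_sets_subset) fact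
        with X have XP: "?X \<in> sets P"
          by blast
        have event: "indicator (event B2) (i2, w) = (indicator ?Y w :: real)" if "w \<in> space P" for w
          using that elim(4) by (simp add: indicator_def event_def space_Q)
        have int_Y: "integrable P (indicator A :: _ \<Rightarrow> real)" if "A \<in> sets P" for A
          using P.cond_exp_indicator(3)[OF sub that] .
        have int_h: "integrable P (\<lambda>w. ?h B2 (i2, w))"
          using elim(2) B2 by blast
        let ?k = "\<lambda>w. indicator ?Y w - ?h B2 (i2, w)"
        have k: "(LINT w:E|P. ?k w) = (LINT w:E|P. indicator (event B2) (i2, w) - ?h B2 (i2, w))" for E
          unfolding set_lebesgue_integral_def by (rule Bochner_Integration.integral_cong) (auto simp: event)
        \<comment> \<open>Vanishing on \<open>K\<close> extends to all of \<open>S\<close>, to which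
          \<open>?X\<close> belongs.\<close>
        have "(LINT w:?X|P. ?k w) = 0"
        proof (rule set_integral_eq_0_sigma_sets[OF _ K(4,3,5)])
          show "integrable P ?k"
            using int_Y[OF Y] int_h by (rule Bochner_Integration.integrable_diff)
          show "(LINT w:E|P. ?k w) = 0" if "E \<in> K" for E
            unfolding k using elim(1) B2 that by blast
          show "?X \<in> sigma_sets (space P) (K \<union> null_sets P)"
            using X unfolding S_def .
        qed
        moreover have "(LINT w:?X|P. ?k w) = (LINT w:?X|P. indicator ?Y w) - (LINT w:?X|P. ?h B2 (i2, w))"
          by (intro set_integral_diff[unfolded set_integrable_def] integrable_mult_indicator XP int_Y[OF Y] int_h)
        moreover have "(LINT w:?X|P. indicat_real ?Y w) = (\<integral>w. indicat_real (?X \<inter> ?Y) w \<partial>P)"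
          unfolding set_lebesgue_integral_def
          by (intro Bochner_Integration.integral_cong) (auto simp: indicator_def)
        moreover have "(\<integral>w. indicat_real (?X \<inter> ?Y) w \<partial>P) = measure P (?X \<inter> ?Y)"
          by (simp add: Int_absorb2 le_infI2)
        ultimately show "measure P (?X \<inter> ?Y) = (LINT w:?X|P. ?h B2 (i2, w))"
          by simp
      qed
    qed
  qed
  then show ?thesis
    unfolding essentially_pairwise_cond_independent_def C_def .
qed

end

theorem theorem3:
  fixes L :: "'i measure" and P :: "'w measure" and Q :: "('i \<times> 'w) measure"
    and f :: "'i \<times> 'w \<Rightarrow> 'x::polish_space"
  assumes "prob_space L" and "complete_measure L" and "atomless L"
    and "prob_space P" and "complete_measure P"
    and "fubini_extension L P Q"
    and "f \<in> borel_measurable Q"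
  shows "countably_generated P (aggregate_algebra L P f) \<and>
    no_coalitional_individual_uncertainty L P Q f (aggregate_algebra L P f) \<and>
    essentially_pairwise_cond_independent L P (aggregate_algebra L P f) f"
proof -
  interpret L: prob_space L by fact
  interpret P: prob_space P by fact
  interpret fubini_process L P Q f
    by (intro fubini_process.intro fubini_process_axioms.intro) fact+
  show ?thesis
    using countably_generated_aggregate no_coalitional_individual_uncertainty_aggregate
      essentially_pairwise_cond_independent_aggregate
    by blast
qed

end
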